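(* Let $G$ be a graph without isolated vertices, with degree sequence $\pi$. Then $G$ is an NG-3 graph if and only if the following four conditions all hold: (i) $\alpha(\pi)$ ends in $2,1$ (its smallest two parts are $2$ and $1$); (ii) $\beta(\pi)$ ends in $4,3$ (its smallest two parts are $4$ and $3$); (iii) $\mathrm{len}(\alpha(\pi))=\mathrm{len}(\beta(\pi))$; (iv) $\tilde\beta\succeq\tilde\alpha$, where $\tilde\beta$ is $\beta(\pi)$ with the smallest two parts removed and $\tilde\alpha$ is $\alpha(\pi)$ with the smallest two parts removed.
   Context: Graphs are finite and simple, with at least one vertex. Degree sequences are written $\pi=(d_1\ge\dots\ge d_r)$. $\alpha(\pi)$ is the partition with $i$-th part $d_i-i+1$ for those $i$ with $d_i\ge i$ (row lengths of the Ferrers diagram of $\pi$ starting at and including the main diagonal); $\beta(\pi)$ is the partition with $j$-th part $|\{i:d_i\ge j\}|-j$ for those $j$ for which this is positive (column lengths below the main diagonal). Both have distinct parts, in decreasing order; $\mathrm{len}$ is the number of parts. For partitions $\delta=(\delta_1,\dots,\delta_s)$ and $\gamma=(\gamma_1,\dots,\gamma_t)$ (possibly empty), $\delta\succeq\gamma$ ($\delta$ majorizes $\gamma$) means that $\delta$ and $\gamma$ partition the same integer and $\sum_{i=1}^m\delta_i\ge\sum_{i=1}^m\gamma_i$ for all $m\le\min\{s,t\}$. A graph $G$ is an NG-graph (Nordhaus–Gaddum graph) if $\chi(G)+\chi(\overline G)=|V(G)|+1$, where $\chi$ is the chromatic number and $\overline G$ the complement. With $A_G=\{v\in V(G):\deg(v)=\chi(G)-1\}$,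 an NG-graph $G$ is an NG-3 graph if the induced subgraph $G[A_G]$ is a 5-cycle. *)

theory Defs
  imports
    "Graph_Theory.Graph_Theory"
    "HOL-Library.Multiset"
    "HOL-Library.Sublist"
begin

text \<open>Finite simple graphs are \<open>pair_graph\<close>s: every edge is represented by its two
  orientations, so the degree of a vertex is its out-degree.\<close>

abbreviation deg :: "'a pair_pre_digraph \<Rightarrow> 'a \<Rightarrow> nat" where
  "deg G v \<equiv> out_degree (with_proj G) v"

definition compl_graph :: "'a pair_pre_digraph \<Rightarrow> 'a pair_pre_digraph" where
  "compl_graph G = \<lparr> pverts = pverts G,
     parcs = {(u, v). u \<in> pverts G \<and> v \<in> pverts G \<and> u \<noteq> v \<and> (u, v) \<notin> parcs G} \<rparr>"

definition colorable :: "'a pair_pre_digraph \<Rightarrow> nat \<Rightarrow> bool" where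
  "colorable G k \<longleftrightarrow>
     (\<exists>f :: 'a \<Rightarrow> nat. f ` pverts G \<subseteq> {..<k} \<and> (\<forall>(u, v) \<in> parcs G. f u \<noteq> f v))"

definition chromatic_number :: "'a pair_pre_digraph \<Rightarrow> nat" where
  "chromatic_number G = (LEAST k. colorable G k)"

text \<open>This is the cycle of length \<open>n\<close> only for \<open>n \<ge> 3\<close>.\<close>

definition cycle_graph :: "nat \<Rightarrow> nat pair_pre_digraph" where
  "cycle_graph n = \<lparr> pverts = {..<n},
     parcs = {(i, j). i < n \<and> j < n \<and> (j = Suc i mod n \<or> i = Suc j mod n)} \<rparr>"

definition NG_graph :: "'a pair_pre_digraph \<Rightarrow> bool" where
  "NG_graph G \<longleftrightarrow>
     chromatic_number G + chromatic_number (compl_graph G) = card (pverts G) + 1"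

definition A_set :: "'a pair_pre_digraph \<Rightarrow> 'a set" where
  "A_set G = {v \<in> pverts G. deg G v = chromatic_number G - 1}"

definition NG3_graph :: "'a pair_pre_digraph \<Rightarrow> bool" where
  "NG3_graph G \<longleftrightarrow>
     NG_graph G \<and> digraph_iso (with_proj G \<restriction> A_set G) (with_proj (cycle_graph 5))"

definition degree_seq :: "'a pair_pre_digraph \<Rightarrow> nat list" where
  "degree_seq G = rev (sorted_list_of_multiset (image_mset (deg G) (mset_set (pverts G))))"

text \<open>A partition is the list of its parts in decreasing order. The indices \<open>i\<close> and \<open>j\<close>
  below count from 1, hence the shift in list access; no subtraction truncates. In
  \<open>beta_part\<close> every \<open>j\<close> with a positive part satisfies \<open>j < length ds\<close>, since a column of the
  Ferrers diagram has at most \<open>length ds\<close> cells.\<close>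

definition alpha_part :: "nat list \<Rightarrow> nat list" where
  "alpha_part ds =
     map (\<lambda>i. ds ! (i - 1) - i + 1) (filter (\<lambda>i. ds ! (i - 1) \<ge> i) [1..<length ds + 1])"

definition column_length :: "nat list \<Rightarrow> nat \<Rightarrow> nat" where
  "column_length ds j = card {i \<in> {1..length ds}. ds ! (i - 1) \<ge> j}"

definition beta_part :: "nat list \<Rightarrow> nat list" where
  "beta_part ds =
     map (\<lambda>j. column_length ds j - j) (filter (\<lambda>j. column_length ds j > j) [1..<length ds + 1])"

definition majorizes :: "nat list \<Rightarrow> nat list \<Rightarrow> bool" (infix \<open>majorizes\<close> 50) where
  "\<delta> majorizes \<gamma> \<longleftrightarrow> sum_list \<delta> = sum_list \<gamma> \<and>
     (\<forall>m \<le> min (length \<delta>) (length \<gamma>). sum_list (take m \<delta>) \<ge> sum_list (take m \<gamma>))"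

definition drop_smallest_two :: "nat list \<Rightarrow> nat list" where
  "drop_smallest_two xs = take (length xs - 2) xs"

end

theory Submission
  imports Defs
begin

text \<open>Both sides of the equivalence describe the same structure, called \<open>C5_split\<close> below:
  the vertex set is partitioned into a five-cycle \<open>A\<close>, a clique \<open>B\<close> and a stable
  set \<open>C\<close>, where every vertex of \<open>B\<close> is adjacent to every vertex of
  \<open>A\<close>, no vertex of \<open>C\<close> is adjacent to a vertex of \<open>A\<close>, and the edges
  between \<open>B\<close> and \<open>C\<close> are arbitrary. Passing to the complement exchanges
  \<open>B\<close> and \<open>C\<close>.

  From chromatic numbers to the structure. Let \<open>\<chi>(G) + \<chi>(complement of G) = n + 1\<close>.
  By the Nordhaus-Gaddum inequality, deleting a vertex of degree at least \<open>\<chi>(G)\<close> leaves a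
  graph with the same property and with \<open>\<chi>\<close> lower by one. If some vertex \<open>u\<close>
  of degree at least \<open>\<chi>(G) - 1\<close> were not adjacent to such a vertex \<open>b\<close>, then
  after deleting \<open>b\<close> the vertex \<open>u\<close> would in turn have degree at least the
  chromatic number, so deleting both would save two colours; but non-adjacent vertices need only one
  (\<open>NG_extremal_adjacent\<close>). Hence the vertices of degree above \<open>\<chi>(G) - 1\<close>
  form a clique joined to those of degree \<open>\<chi>(G) - 1\<close>, which induce a five-cycle by the
  definition of NG-3 graphs, and the dual statement in the complement handles the vertices of smaller
  degree. Conversely, the structure forces \<open>\<chi>(G) = |B| + 3\<close>, and likewise \<open>|C| +
  3\<close> for the complement, and it makes \<open>A\<close> the set of vertices of degree \<open>\<chi>(G)
  - 1\<close>.

  From degree sequences to the structure. For a set \<open>S\<close> of vertices whose degrees are at least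
  \<open>|S|\<close>, double counting the adjacent pairs with first vertex in \<open>S\<close> gives the
  Erdos-Gallai inequality \<open>(\<Sum>v\<in>S. deg v) + |S| \<le> (\<Sum>v\<in>V. min (deg v)
  |S|)\<close>, whose right-hand side is the sum of the first \<open>|S|\<close> columns of the Ferrers
  diagram. For \<open>S\<close> the first \<open>m\<close> vertices in the order of the
  degree sequence, this is the \<open>m\<close>-th majorization inequality. Equality of the totals is the equality case for the set \<open>B\<close> of the
  first \<open>p\<close> vertices, where \<open>p + 2\<close> is the common number of parts of the two
  partitions. It says that \<open>B\<close> is a clique joined to every vertex of degree at least
  \<open>p\<close> outside \<open>B\<close>, and that the other vertices outside \<open>B\<close> have neighbours in
  \<open>B\<close> only (\<open>Erdos_Gallai_eq_iff\<close>). The conditions on the smallest parts and on the lengths say that exactly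
  \<open>p + 5\<close> vertices have degree greater than \<open>p\<close>, and that the last five of them have
  degree \<open>p + 2\<close>. So these five induce a \<open>2\<close>-regular graph, which is a five-cycle.\<close>

section \<open>Colourings of vertex sets\<close>

text \<open>Colourings are taken on subsets \<open>S\<close> of the vertices with the edge relation \<open>E\<close> left as it is,
  so that deleting a vertex is a set difference and the complement does not depend on \<open>S\<close>.\<close>

definition proper_colouring :: "'a rel \<Rightarrow> 'a set \<Rightarrow> nat \<Rightarrow> ('a \<Rightarrow> nat) \<Rightarrow> bool" where
  "proper_colouring E S k f \<longleftrightarrow>
     f ` S \<subseteq> {..<k} \<and> (\<forall>u\<in>S. \<forall>v\<in>S. (u, v) \<in> E \<longrightarrow> f u \<noteq> f v)"

definition chi :: "'a rel \<Rightarrow> 'a set \<Rightarrow> nat" where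
  "chi E S = (LEAST k. \<exists>f. proper_colouring E S k f)"

definition co :: "'a rel \<Rightarrow> 'a rel" where
  "co E = {(u, v). u \<noteq> v \<and> (u, v) \<notin> E}"

definition deg_in :: "'a rel \<Rightarrow> 'a set \<Rightarrow> 'a \<Rightarrow> nat" where
  "deg_in E S v = card {u \<in> S. (v, u) \<in> E}"

lemma sym_co: "sym E \<Longrightarrow> sym (co E)"
  by (auto simp: co_def sym_def)

lemma irrefl_co: "irrefl (co E)"
  by (auto simp: co_def irrefl_def)

lemma co_co: "irrefl E \<Longrightarrow> co (co E) = E"
  by (auto simp: co_def irrefl_def)

lemma deg_in_co:
  assumes "finite S" "irrefl E" "v \<in> S"
  shows "deg_in E S v + deg_in (co E) S v + 1 = card S"
proof -
  have "S = insert v ({u \<in> S. (v, u) \<in> E} \<union> {u \<in> S. (v, u) \<in> co E})"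
    using assms(3) by (auto simp: co_def)
  moreover have "card (insert v ({u \<in> S. (v, u) \<in> E} \<union> {u \<in> S. (v, u) \<in> co E}))
      = Suc (card ({u \<in> S. (v, u) \<in> E} \<union> {u \<in> S. (v, u) \<in> co E}))"
    using assms by (intro card_insert_disjoint) (auto simp: co_def irrefl_def)
  moreover have "card ({u \<in> S. (v, u) \<in> E} \<union> {u \<in> S. (v, u) \<in> co E})
      = deg_in E S v + deg_in (co E) S v"
    unfolding deg_in_def using assms by (intro card_Un_disjoint) (auto simp: co_def)
  ultimately show ?thesis by simp
qed

lemma deg_in_remove:
  assumes "irrefl E"
  shows "deg_in E (S - {v}) v = deg_in E S v"
proof -
  have "{u \<in> S - {v}. (v, u) \<in> E} = {u \<in> S. (v, u) \<in> E}"
    using assms by (auto simp: irrefl_def)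
  then show ?thesis by (simp add: deg_in_def)
qed

lemma deg_in_remove_nonneighbour:
  assumes "(v, w) \<notin> E"
  shows "deg_in E (S - {w}) v = deg_in E S v"
proof -
  have "{u \<in> S - {w}. (v, u) \<in> E} = {u \<in> S. (v, u) \<in> E}" using assms by auto
  then show ?thesis by (simp add: deg_in_def)
qed

lemma chi_le: "proper_colouring E S k f \<Longrightarrow> chi E S \<le> k"
  unfolding chi_def by (rule Least_le) blast

lemma proper_colouring_chi:
  assumes "finite S" "irrefl E"
  obtains f where "proper_colouring E S (chi E S) f"
proof -
  obtain f n where f: "f ` S = {i::nat. i < n}" "inj_on f S"
    using finite_imp_inj_to_nat_seg[OF assms(1)] by metis
  have "proper_colouring E S n f"
    using f assms(2) unfolding proper_colouring_def inj_on_def irrefl_def by blast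
  then have "\<exists>k f. proper_colouring E S k f" by blast
  then have "\<exists>f. proper_colouring E S (chi E S) f"
    unfolding chi_def by (rule LeastI_ex)
  then show thesis using that by blast
qed

lemma chi_pos:
  assumes "finite S" "irrefl E" "S \<noteq> {}"
  shows "chi E S > 0"
proof -
  obtain f where "proper_colouring E S (chi E S) f" using proper_colouring_chi assms by blast
  then show ?thesis using assms(3) by (auto simp: proper_colouring_def)
qed

lemma chi_union_stable:
  assumes "finite S" "irrefl E" and T: "\<forall>u\<in>T. \<forall>v\<in>T. (u, v) \<notin> E"
  shows "chi E (S \<union> T) \<le> chi E S + 1"
proof -
  obtain f where f: "proper_colouring E S (chi E S) f" using proper_colouring_chi assms by blast
  have "proper_colouring E (S \<union> T) (chi E S + 1) (\<lambda>x. if x \<in> T then chi E S else f x)"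
  proof -
    have "f x < chi E S" if "x \<in> S" for x using f that by (auto simp: proper_colouring_def)
    then show ?thesis
      using f T unfolding proper_colouring_def image_subset_iff
      by (auto simp: less_Suc_eq) (metis less_irrefl)+
  qed
  then show ?thesis by (rule chi_le)
qed

text \<open>A vertex with fewer neighbours than there are colours can be coloured greedily.\<close>

lemma chi_insert_low_degree:
  assumes "finite S" "sym E" "irrefl E" "deg_in E S v < chi E S"
  shows "chi E (insert v S) \<le> chi E S"
proof -
  obtain f where f: "proper_colouring E S (chi E S) f" using proper_colouring_chi assms by blast
  let ?N = "{u \<in> S. (v, u) \<in> E}"
  have "card (f ` ?N) < card {..<chi E S}"
    using assms(1,4) card_image_le[of ?N f] by (simp add: deg_in_def)
  then have "\<not> {..<chi E S} \<subseteq> f ` ?N"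
    using assms(1) card_mono[of "f ` ?N" "{..<chi E S}"] by auto
  then obtain c where c: "c < chi E S" "c \<notin> f ` ?N" by auto
  have "proper_colouring E (insert v S) (chi E S) (f(v := c))"
    using f c assms(2,3) unfolding proper_colouring_def irrefl_def sym_def
    by (auto simp: image_subset_iff)
  then show ?thesis by (rule chi_le)
qed

lemma chi_le_remove:
  assumes "finite S" "irrefl E" "v \<in> S"
  shows "chi E S \<le> chi E (S - {v}) + 1"
  using chi_union_stable[of "S - {v}" E "{v}"] assms
  by (auto simp: irrefl_def insert_absorb)

lemma chi_le_remove_low_degree:
  assumes "finite S" "sym E" "irrefl E" "v \<in> S" "deg_in E S v < chi E (S - {v})"
  shows "chi E S \<le> chi E (S - {v})"
  using chi_insert_low_degree[of "S - {v}" E v] assms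
  by (simp add: deg_in_remove insert_absorb)

section \<open>The Nordhaus-Gaddum bound and its extremal graphs\<close>

text \<open>Removing a vertex lowers the sum of the two chromatic numbers by at most two, and by two
  only if the vertex has many neighbours both in the graph and in its complement; its two degrees
  sum to one less than the number of vertices, which caps the sum in that case.\<close>

lemma Nordhaus_Gaddum:
  assumes "finite S" "sym E" "irrefl E"
  shows "chi E S + chi (co E) S \<le> card S + 1"
  using assms(1)
proof (induction "card S" arbitrary: S)
  case 0
  then have "proper_colouring F S 0 f" for F :: "'a rel" and f by (simp add: proper_colouring_def)
  then have "chi F S = 0" for F :: "'a rel" using chi_le[of F S 0] by fastforce
  then show ?case by simp
next
  case (Suc n)
  then obtain v where v: "v \<in> S" by fastforce
  let ?T = "S - {v}"
  note fin = Suc.prems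
  have n: "card S = Suc n" "card ?T = n" using Suc v by auto
  have IH: "chi E ?T + chi (co E) ?T \<le> n + 1" using Suc.hyps(1)[of ?T] n fin by simp
  have up: "chi E S \<le> chi E ?T + 1" "chi (co E) S \<le> chi (co E) ?T + 1"
    using chi_le_remove fin v assms(3) irrefl_co by metis+
  have low: "deg_in E S v < chi E ?T \<Longrightarrow> chi E S \<le> chi E ?T"
    "deg_in (co E) S v < chi (co E) ?T \<Longrightarrow> chi (co E) S \<le> chi (co E) ?T"
    using chi_le_remove_low_degree fin v assms(2,3) irrefl_co sym_co by metis+
  have "deg_in E S v + deg_in (co E) S v + 1 = card S" using deg_in_co fin v assms(3) by metis
  then show ?case using IH up low n by linarith
qed

definition NG_extremal :: "'a rel \<Rightarrow> 'a set \<Rightarrow> bool" where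
  "NG_extremal E S \<longleftrightarrow> chi E S + chi (co E) S = card S + 1"

lemma NG_extremal_co: "irrefl E \<Longrightarrow> NG_extremal (co E) S = NG_extremal E S"
  by (simp add: NG_extremal_def co_co add.commute)

text \<open>The degree of such a vertex in the complement is so small that a colouring of the rest of the
  complement extends to it. So its removal keeps the chromatic number of the complement, and the
  Nordhaus-Gaddum bound for the remaining vertices makes the other one drop.\<close>

lemma NG_extremal_remove_high_degree:
  assumes "finite S" "sym E" "irrefl E" "NG_extremal E S" "v \<in> S" "chi E S \<le> deg_in E S v"
  shows "NG_extremal E (S - {v})" "chi E S = chi E (S - {v}) + 1"
proof -
  let ?T = "S - {v}"
  have "chi (co E) S \<le> chi (co E) ?T + 1"
    using chi_le_remove assms irrefl_co by metis
  moreover have "deg_in (co E) S v < chi (co E) ?T \<Longrightarrow> chi (co E) S \<le> chi (co E) ?T"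
    using chi_le_remove_low_degree assms irrefl_co sym_co by metis
  moreover have "deg_in E S v + deg_in (co E) S v + 1 = card S"
    using deg_in_co assms by metis
  moreover have "chi E S \<le> chi E ?T + 1" using chi_le_remove assms by metis
  moreover have "chi E ?T + chi (co E) ?T \<le> card ?T + 1"
    using Nordhaus_Gaddum[of ?T E] assms by simp
  moreover have "card S = card ?T + 1" using assms(1,5) card_Suc_Diff1[of S v] by simp
  ultimately show "NG_extremal E ?T" "chi E S = chi E ?T + 1"
    using assms(4,6) unfolding NG_extremal_def by linarith+
qed

text \<open>If \<open>b\<close> and \<open>u\<close> were not adjacent, removing \<open>b\<close> would keep the degree of \<open>u\<close> and lower the
  chromatic number to at most that degree. Removing both would then lower the chromatic number by two,
  but two non-adjacent vertices can share a colour.\<close>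

lemma NG_extremal_adjacent:
  assumes "finite S" "sym E" "irrefl E" "NG_extremal E S" "b \<in> S" "u \<in> S" "u \<noteq> b"
    and b: "chi E S \<le> deg_in E S b" and u: "chi E S - 1 \<le> deg_in E S u"
  shows "(b, u) \<in> E"
proof (rule ccontr)
  assume non: "(b, u) \<notin> E"
  then have non': "(u, b) \<notin> E" using assms(2) by (auto simp: sym_def)
  let ?T = "S - {b}" and ?U = "S - {b} - {u}"
  have 1: "NG_extremal E ?T" "chi E S = chi E ?T + 1"
    using NG_extremal_remove_high_degree[of S E b] assms by auto
  have "chi E ?T \<le> deg_in E ?T u"
    using u 1 deg_in_remove_nonneighbour[OF non', of S] by simp
  then have 2: "chi E ?T = chi E ?U + 1"
    using NG_extremal_remove_high_degree[of ?T E u] assms 1 by auto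
  have "chi E (?U \<union> {b, u}) \<le> chi E ?U + 1"
    using non non' assms by (intro chi_union_stable) (auto simp: irrefl_def)
  moreover have "?U \<union> {b, u} = S" using assms by auto
  ultimately show False using 1 2 by simp
qed

text \<open>This is \<open>NG_extremal_adjacent\<close> for the complement, where the order of the degrees is reversed.\<close>

lemma NG_extremal_nonadjacent:
  assumes "finite S" "sym E" "irrefl E" "NG_extremal E S" "c \<in> S" "u \<in> S"
    and c: "deg_in E S c < chi E S - 1" and u: "deg_in E S u \<le> chi E S - 1"
  shows "(c, u) \<notin> E"
proof (cases "u = c")
  case True
  then show ?thesis using assms(3) by (auto simp: irrefl_def)
next
  case False
  have "deg_in E S c + deg_in (co E) S c + 1 = card S"
    "deg_in E S u + deg_in (co E) S u + 1 = card S"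
    using deg_in_co assms(1,3,5,6) by metis+
  moreover have "chi E S > 0" using chi_pos assms(1,3,5) by blast
  ultimately have "chi (co E) S \<le> deg_in (co E) S c" "chi (co E) S - 1 \<le> deg_in (co E) S u"
    using c u assms(4) unfolding NG_extremal_def by linarith+
  then have "(c, u) \<in> co E"
    using NG_extremal_adjacent[of S "co E" c u] assms False
    by (simp add: sym_co irrefl_co NG_extremal_co)
  then show ?thesis by (simp add: co_def)
qed

section \<open>Joining a five-cycle to a clique and a stable set\<close>

text \<open>The pentagon is induced: the five diagonals are non-edges, and in the complement they form a
  pentagon again.\<close>

definition pentagon :: "'a rel \<Rightarrow> 'a \<Rightarrow> 'a \<Rightarrow> 'a \<Rightarrow> 'a \<Rightarrow> 'a \<Rightarrow> bool" where
  "pentagon E a b c d e \<longleftrightarrow> distinct [a, b, c, d, e] \<and>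
     (a, b) \<in> E \<and> (b, c) \<in> E \<and> (c, d) \<in> E \<and> (d, e) \<in> E \<and> (e, a) \<in> E \<and>
     (a, c) \<notin> E \<and> (c, e) \<notin> E \<and> (e, b) \<notin> E \<and> (b, d) \<notin> E \<and> (d, a) \<notin> E"

definition five_cycle :: "'a rel \<Rightarrow> 'a set \<Rightarrow> bool" where
  "five_cycle E A \<longleftrightarrow> (\<exists>a b c d e. A = {a, b, c, d, e} \<and> pentagon E a b c d e)"

lemma pentagon_reverse:
  assumes "sym E" "pentagon E a b c d e"
  shows "pentagon E a e d c b"
proof -
  have "(x, y) \<in> E \<longleftrightarrow> (y, x) \<in> E" for x y using assms(1) by (auto simp: sym_def)
  note flip = this[of a e] this[of e d] this[of d c] this[of c b] this[of b a]
    this[of a d] this[of d b] this[of b e] this[of e c] this[of c a]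
  show ?thesis using assms(2) unfolding pentagon_def by (simp add: flip) auto
qed

lemma five_cycle_co:
  assumes "sym E" "five_cycle E A"
  shows "five_cycle (co E) A"
proof -
  obtain a b c d e where A: "A = {a, b, c, d, e}" and p: "pentagon E a b c d e"
    using assms(2) unfolding five_cycle_def by metis
  have "pentagon E a e d c b" using pentagon_reverse assms(1) p by metis
  then have "pentagon (co E) a c e b d" using p unfolding pentagon_def co_def by auto
  moreover have "A = {a, c, e, b, d}" using A by (simp add: insert_commute)
  ultimately show ?thesis unfolding five_cycle_def by metis
qed

lemma card_five_cycle:
  assumes "five_cycle E A"
  shows "card A = 5"
proof -
  obtain a b c d e where A: "A = {a, b, c, d, e}" and p: "pentagon E a b c d e"
    using assms unfolding five_cycle_def by metis
  show ?thesis using p unfolding A pentagon_def by simp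
qed

lemma deg_in_five_cycle:
  assumes "sym E" "irrefl E" "five_cycle E A" "v \<in> A"
  shows "deg_in E A v = 2"
proof -
  obtain a b c d e where A: "A = {a, b, c, d, e}" and p: "pentagon E a b c d e"
    using assms(3) unfolding five_cycle_def by metis
  have q: "pentagon E a e d c b" using pentagon_reverse assms(1) p by metis
  have irr: "(x, x) \<notin> E" for x using assms(2) by (auto simp: irrefl_def)
  have "{u \<in> A. (a, u) \<in> E} = {b, e}" "{u \<in> A. (b, u) \<in> E} = {a, c}"
    "{u \<in> A. (c, u) \<in> E} = {b, d}" "{u \<in> A. (d, u) \<in> E} = {c, e}"
    "{u \<in> A. (e, u) \<in> E} = {a, d}"
    using p q irr unfolding A pentagon_def by auto
  then have "card {u \<in> A. (x, u) \<in> E} = 2" if "x \<in> {a, b, c, d, e}" for x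
    using that p unfolding pentagon_def by (elim insertE) auto
  then show ?thesis using assms(4) unfolding A deg_in_def by simp
qed

lemma colours_five_cycle:
  assumes "five_cycle E A" "proper_colouring E A k f"
  shows "card (f ` A) \<ge> 3"
proof (rule ccontr)
  assume "\<not> ?thesis"
  then have "card (f ` A) \<le> 2" by simp
  moreover have "f ` A \<noteq> {}" "finite (f ` A)" using assms by (auto simp: five_cycle_def)
  ultimately have "card (f ` A) = 1 \<or> card (f ` A) = 2"
    by (metis One_nat_def Suc_1 card_0_eq le_Suc_eq le_zero_eq)
  then have "\<exists>x y. f ` A = {x, y}"
  proof
    assume "card (f ` A) = 1"
    then obtain x where "f ` A = {x}" by (rule card_1_singletonE)
    then have "f ` A = {x, x}" by simp
    then show ?thesis by (intro exI)
  next
    assume "card (f ` A) = 2"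
    then show ?thesis unfolding card_2_iff by (elim exE conjE) (intro exI)
  qed
  then obtain x y where "f ` A = {x, y}" by (elim exE)
  then have xy: "f v = x \<or> f v = y" if "v \<in> A" for v using that by auto
  obtain a b c d e where A: "A = {a, b, c, d, e}" and p: "pentagon E a b c d e"
    using assms(1) unfolding five_cycle_def by metis
  then have "f a \<noteq> f b" "f b \<noteq> f c" "f c \<noteq> f d" "f d \<noteq> f e" "f e \<noteq> f a"
    using assms(2) p unfolding proper_colouring_def pentagon_def A by simp_all
  then show False using xy[of a] xy[of b] xy[of c] xy[of d] xy[of e] unfolding A by auto
qed

lemma colouring_five_cycle:
  assumes "sym E" "irrefl E" "five_cycle E A"
  obtains f where "proper_colouring E A 3 f"
proof -
  obtain a b c d e where A: "A = {a, b, c, d, e}" and p: "pentagon E a b c d e"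
    using assms(3) unfolding five_cycle_def by metis
  have q: "pentagon E a e d c b" using pentagon_reverse assms(1) p by metis
  have irr: "(x, x) \<notin> E" for x using assms(2) by (auto simp: irrefl_def)
  let ?f = "\<lambda>x. if x = a \<or> x = c then 0 else if x = b \<or> x = d then 1 else (2::nat)"
  have "proper_colouring E A 3 ?f"
    using p q irr unfolding proper_colouring_def A pentagon_def by auto
  then show thesis by (rule that)
qed

text \<open>From a vertex \<open>a\<close>, walk one step and then a second step in both directions. The five vertices
  met are distinct, since a shorter cycle would be a component that leaves too few vertices for another
  cycle.\<close>

lemma two_regular_five_cycle:
  assumes "sym E" "irrefl E" "card A = 5" and reg: "\<forall>v\<in>A. deg_in E A v = 2"
  shows "five_cycle E A"
proof -
  define N where "N v = {u \<in> A. (v, u) \<in> E}" for v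
  have fin: "finite A" using assms(3) card.infinite by fastforce
  have ed: "(x, y) \<in> E \<longleftrightarrow> (y, x) \<in> E" "(x, x) \<notin> E" for x y
    using assms(1,2) by (auto simp: sym_def irrefl_def)
  have N2: "card (N v) = 2" if "v \<in> A" for v using reg that by (simp add: N_def deg_in_def)
  have NA: "N v \<subseteq> A" for v by (auto simp: N_def)
  have Nsym: "u \<in> N v" if "v \<in> N u" "u \<in> A" for u v
    using ed(1)[of u v] that by (simp add: N_def)
  have Nirr: "v \<notin> N v" for v using ed(2) by (simp add: N_def)
  have other: "\<exists>w. w \<noteq> u \<and> N v = {u, w}" if "u \<in> N v" "v \<in> A" for u v
    using N2[OF that(2)] that(1) unfolding card_2_iff by (metis insert_commute insertE singletonD)
  have both: "N v = {u, w}" if "u \<in> N v" "w \<in> N v" "u \<noteq> w" "v \<in> A" for u v w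
    using other[OF that(1,4)] that(2,3) by auto
  (* a union of components leaves out no vertex or at least three of them *)
  have closed: False if T: "T \<subseteq> A" "\<forall>t\<in>T. N t \<subseteq> T" and "card T = 3 \<or> card T = 4" for T
  proof -
    have "finite T" using T fin finite_subset by metis
    then have R: "card (A - T) + card T = 5"
      using T assms(3) fin by (metis card_Diff_subset card_mono le_add_diff_inverse2)
    then have "card (A - T) \<noteq> 0" using that(3) by linarith
    then have "A - T \<noteq> {}" by (metis card.empty)
    then obtain x where x: "x \<in> A" "x \<notin> T" by blast
    have "N x \<subseteq> A - T - {x}"
      using T Nsym[OF _ x(1)] Nirr[of x] NA[of x] x(2) by blast
    then have "card (N x) \<le> card (A - T - {x})" using fin by (intro card_mono) auto
    moreover have "card (A - T) = card (A - T - {x}) + 1"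
      using x fin by (metis DiffI Suc_eq_plus1 card_Suc_Diff1 finite_Diff)
    ultimately show False using N2[OF x(1)] R that(3) by linarith
  qed
  obtain a where a: "a \<in> A" using assms(3) by fastforce
  obtain b e where be: "b \<noteq> e" "N a = {b, e}" using N2[OF a] unfolding card_2_iff by metis
  then have beA: "b \<in> A" "e \<in> A" "b \<noteq> a" "e \<noteq> a" using NA[of a] Nirr[of a] by auto
  have ab: "a \<in> N b" "a \<in> N e" using Nsym[of _ a] a be(2) by simp_all
  obtain c where c: "c \<noteq> a" "N b = {a, c}" using other[OF ab(1) beA(1)] by metis
  obtain d where d: "d \<noteq> a" "N e = {a, d}" using other[OF ab(2) beA(2)] by metis
  have cdA: "c \<in> A" "d \<in> A" "c \<noteq> b" "d \<noteq> e"
    using c(2) d(2) NA[of b] NA[of e] Nirr[of b] Nirr[of e] by auto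
  have bc: "b \<in> N c" "e \<in> N d" using Nsym[OF _ beA(1)] Nsym[OF _ beA(2)] c(2) d(2) by simp_all
  have ce: "c \<noteq> e"
  proof
    assume "c = e"
    then have "N e = {a, b}" using both[of a e b] ab(2) bc(1) beA by simp
    then have "\<forall>t\<in>{a, b, e}. N t \<subseteq> {a, b, e}" using be(2) c(2) \<open>c = e\<close> by simp
    moreover have "card {a, b, e} = 3" using be(1) beA by simp
    ultimately show False using closed[of "{a, b, e}"] a beA by simp
  qed
  have db: "d \<noteq> b"
  proof
    assume "d = b"
    then have "e \<in> N b" using bc(2) by simp
    then show False using c(2) ce beA by simp
  qed
  have cd: "c \<noteq> d"
  proof
    assume "c = d"
    then have "N c = {b, e}" using both[of b c e] bc be(1) cdA by simp
    then have "\<forall>t\<in>{a, b, e, c}. N t \<subseteq> {a, b, e, c}" using be(2) c(2) d(2) \<open>c = d\<close> by simp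
    moreover have "card {a, b, e, c} = 4" using be(1) beA c(1) ce cdA(3) by simp
    ultimately show False using closed[of "{a, b, e, c}"] a beA cdA by simp
  qed
  have dist: "distinct [a, b, c, d, e]" using beA(3,4) be(1) c(1) d(1) cdA(3,4) ce db cd by simp
  then have "card {a, b, c, d, e} = 5" by simp
  then have A: "A = {a, b, c, d, e}"
    using card_subset_eq[OF fin, of "{a, b, c, d, e}"] a beA cdA assms(3) by simp
  obtain w where w: "w \<noteq> b" "N c = {b, w}" using other[OF bc(1) cdA(1)] by metis
  have wA: "w \<in> A" "w \<noteq> c" "c \<in> N w" using w(2) NA[of c] Nirr[of c] Nsym[OF _ cdA(1)] by auto
  have "w \<noteq> a" "w \<noteq> e" using wA(3) be(2) d(2) dist by auto
  then have "w = d" using wA(1,2) w(1) unfolding A by simp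
  then have Nc: "N c = {b, d}" using w(2) by simp
  have E: "(x, y) \<in> E \<longleftrightarrow> y \<in> N x" if "y \<in> A" for x y using that by (simp add: N_def)
  have "(a, b) \<in> E" "(b, c) \<in> E" "(c, d) \<in> E" "(e, d) \<in> E" "(e, a) \<in> E"
    "(a, c) \<notin> E" "(c, e) \<notin> E" "(e, b) \<notin> E" "(b, d) \<notin> E" "(a, d) \<notin> E"
    using E[OF a] E[OF beA(1)] E[OF beA(2)] E[OF cdA(1)] E[OF cdA(2)] be(2) c(2) d(2) Nc dist
    by auto
  then have "pentagon E a b c d e"
    using dist symD[OF assms(1), of e d] symD[OF assms(1), of d a] unfolding pentagon_def by blast
  then show ?thesis using A unfolding five_cycle_def by metis
qed

text \<open>The graphs with such a partition are the pseudo-split graphs that are not split graphs.\<close>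

definition C5_split :: "'a rel \<Rightarrow> 'a set \<Rightarrow> 'a set \<Rightarrow> 'a set \<Rightarrow> 'a set \<Rightarrow> bool" where
  "C5_split E V A B C \<longleftrightarrow>
     V = A \<union> B \<union> C \<and> A \<inter> B = {} \<and> A \<inter> C = {} \<and> B \<inter> C = {} \<and> five_cycle E A \<and>
     (\<forall>b\<in>B. \<forall>u\<in>A \<union> B. u \<noteq> b \<longrightarrow> (b, u) \<in> E) \<and>
     (\<forall>c\<in>C. \<forall>u\<in>A \<union> C. (c, u) \<notin> E)"

lemma C5_splitD:
  assumes "C5_split E V A B C" "sym E"
  shows "V = A \<union> B \<union> C" "A \<inter> B = {}" "A \<inter> C = {}" "B \<inter> C = {}" "five_cycle E A"
    and "\<And>b u. b \<in> B \<Longrightarrow> u \<in> A \<union> B \<Longrightarrow> u \<noteq> b \<Longrightarrow> (b, u) \<in> E"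
    and "\<And>b u. b \<in> B \<Longrightarrow> u \<in> A \<union> B \<Longrightarrow> u \<noteq> b \<Longrightarrow> (u, b) \<in> E"
    and "\<And>c u. c \<in> C \<Longrightarrow> u \<in> A \<union> C \<Longrightarrow> (c, u) \<notin> E"
    and "\<And>c u. c \<in> C \<Longrightarrow> u \<in> A \<union> C \<Longrightarrow> (u, c) \<notin> E"
proof -
  note s = assms(1)[unfolded C5_split_def]
  show "V = A \<union> B \<union> C" "A \<inter> B = {}" "A \<inter> C = {}" "B \<inter> C = {}" "five_cycle E A"
    using s by simp_all
  show "(b, u) \<in> E" "(u, b) \<in> E" if "b \<in> B" "u \<in> A \<union> B" "u \<noteq> b" for b u
  proof -
    show "(b, u) \<in> E" using s that by simp
    then show "(u, b) \<in> E" using symD[OF assms(2)] by metis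
  qed
  show "(c, u) \<notin> E" "(u, c) \<notin> E" if "c \<in> C" "u \<in> A \<union> C" for c u
  proof -
    show "(c, u) \<notin> E" using s that by simp
    then show "(u, c) \<notin> E" using symD[OF assms(2)] by metis
  qed
qed

lemma C5_split_co:
  assumes "sym E" "C5_split E V A B C"
  shows "C5_split (co E) V A C B"
proof -
  note s = C5_splitD[OF assms(2,1)]
  have "(c, u) \<in> co E" if "c \<in> C" "u \<in> A \<union> C" "u \<noteq> c" for c u
    using s(8)[of c u] that by (simp add: co_def)
  moreover have "(b, u) \<notin> co E" if "b \<in> B" "u \<in> A \<union> B" for b u
    using s(6)[of b u] that by (auto simp: co_def)
  moreover have "V = A \<union> C \<union> B" using s(1) by auto
  ultimately show ?thesis
    unfolding C5_split_def using s(2-4) five_cycle_co[OF assms(1) s(5)] by (simp add: Int_commute)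
qed

text \<open>The vertices of \<open>B\<close> need colours of their own, and the five-cycle needs three more.\<close>

lemma chi_C5_split:
  assumes "finite V" "sym E" "irrefl E" "C5_split E V A B C"
  shows "chi E V = card B + 3"
proof (rule antisym)
  note s = C5_splitD[OF assms(4,2)]
  have fin: "finite A" "finite B" "finite C" using assms(1) unfolding s(1) by auto
  have irr: "(x, x) \<notin> E" for x using assms(3) by (auto simp: irrefl_def)
  obtain f where f: "proper_colouring E A 3 f" using colouring_five_cycle s(5) assms(2,3) by metis
  obtain g where g: "bij_betw g B {0..<card B}" using ex_bij_betw_finite_nat fin(2) by metis
  (* C is not joined to the five-cycle, so it can reuse one of its colours *)
  define h where "h x = (if x \<in> B then g x + 3 else if x \<in> A then f x else 0)" for x
  have gB: "g x < card B" if "x \<in> B" for x using g that by (auto simp: bij_betw_def)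
  have gi: "g x = g y \<longleftrightarrow> x = y" if "x \<in> B" "y \<in> B" for x y
    using g that by (auto simp: bij_betw_def inj_on_def)
  have fA: "f x < 3" if "x \<in> A" for x using f that by (auto simp: proper_colouring_def)
  have fp: "f x \<noteq> f y" if "x \<in> A" "y \<in> A" "(x, y) \<in> E" for x y
    using f that by (auto simp: proper_colouring_def)
  have h1: "h x < card B + 3" for x using gB[of x] fA[of x] by (auto simp: h_def)
  have h2: "h x \<noteq> h y" if xy: "x \<in> V" "y \<in> V" "(x, y) \<in> E" for x y
  proof -
    have "x \<in> A \<or> x \<in> B \<or> x \<in> C" "y \<in> A \<or> y \<in> B \<or> y \<in> C" using s(1) xy by auto
    moreover have "x \<in> C \<Longrightarrow> y \<in> B" using s(1) s(8)[of x y] xy by auto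
    moreover have "y \<in> C \<Longrightarrow> x \<in> B" using s(1) s(9)[of y x] xy by auto
    ultimately consider "x \<in> A" "y \<in> A" | "x \<in> B" "y \<in> B" | "x \<in> B" "y \<notin> B" | "x \<notin> B" "y \<in> B"
      by blast
    then show ?thesis
    proof cases
      case 1 then show ?thesis using fp xy s(2) by (auto simp: h_def disjoint_iff)
    next
      case 2 then show ?thesis using gi xy irr by (auto simp: h_def)
    next
      case 3 then show ?thesis using fA[of y] by (auto simp: h_def)
    next
      case 4 then show ?thesis using fA[of x] by (auto simp: h_def)
    qed
  qed
  have "proper_colouring E V (card B + 3) h"
    unfolding proper_colouring_def using h1 h2 by blast
  then show "chi E V \<le> card B + 3" by (rule chi_le)
next
  note s = C5_splitD[OF assms(4,2)]
  have fin: "finite A" "finite B" "finite C" using assms(1) unfolding s(1) by auto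
  obtain f where f: "proper_colouring E V (chi E V) f" using proper_colouring_chi assms(1,3) by metis
  then have p: "f x \<noteq> f y" if "x \<in> V" "y \<in> V" "(x, y) \<in> E" for x y
    using that by (auto simp: proper_colouring_def)
  have sub: "A \<subseteq> V" "B \<subseteq> V" using s(1) by auto
  have "proper_colouring E A (chi E V) f"
    using f sub unfolding proper_colouring_def by blast
  then have "card (f ` A) \<ge> 3" using colours_five_cycle s(5) by blast
  moreover have "inj_on f B"
  proof (rule inj_onI)
    show "x = y" if "x \<in> B" "y \<in> B" "f x = f y" for x y
      using p[of x y] s(6)[of x y] that sub by auto
  qed
  then have "card (f ` B) = card B" by (rule card_image)
  moreover have "f x \<noteq> f y" if "x \<in> A" "y \<in> B" for x y
  proof -
    have "x \<noteq> y" using that s(2) by auto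
    then show ?thesis using p[of x y] s(7)[of y x] that sub by auto
  qed
  then have "f ` A \<inter> f ` B = {}" by blast
  then have "card (f ` A \<union> f ` B) = card (f ` A) + card (f ` B)"
    using fin by (simp add: card_Un_disjoint)
  moreover have "f ` A \<union> f ` B \<subseteq> {..<chi E V}"
    using f sub unfolding proper_colouring_def by blast
  then have "card (f ` A \<union> f ` B) \<le> card {..<chi E V}"
    by (intro card_mono) auto
  ultimately show "card B + 3 \<le> chi E V" by simp
qed

lemma deg_in_C5_split:
  assumes "finite V" "sym E" "irrefl E" "C5_split E V A B C"
  shows "v \<in> A \<Longrightarrow> deg_in E V v = card B + 2"
    and "v \<in> B \<Longrightarrow> deg_in E V v \<ge> card B + 4"
    and "v \<in> C \<Longrightarrow> deg_in E V v \<le> card B"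
proof -
  note s = C5_splitD[OF assms(4,2)]
  have fin: "finite A" "finite B" "finite C" using assms(1) unfolding s(1) by auto
  show "deg_in E V v = card B + 2" if v: "v \<in> A"
  proof -
    have 1: "(v, u) \<in> E" if "u \<in> B" for u
      using s(7)[of u v] s(2) that v by auto
    have 2: "(v, u) \<notin> E" if "u \<in> C" for u using s(9)[of u v] that v by auto
    have "{u \<in> V. (v, u) \<in> E} = B \<union> {u \<in> A. (v, u) \<in> E}"
      unfolding s(1) using 1 2 by auto
    moreover have "card (B \<union> {u \<in> A. (v, u) \<in> E}) = card B + card {u \<in> A. (v, u) \<in> E}"
      using fin s(2) by (intro card_Un_disjoint) auto
    moreover have "card {u \<in> A. (v, u) \<in> E} = 2"
      using deg_in_five_cycle[OF assms(2,3) s(5) v] by (simp add: deg_in_def)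
    ultimately show ?thesis by (simp add: deg_in_def)
  qed
  show "deg_in E V v \<ge> card B + 4" if v: "v \<in> B"
  proof -
    have "A \<union> (B - {v}) \<subseteq> {u \<in> V. (v, u) \<in> E}"
      unfolding s(1) using v s(2) s(6)[of v] by auto
    then have "card (A \<union> (B - {v})) \<le> deg_in E V v"
      unfolding deg_in_def using assms(1) by (intro card_mono) auto
    moreover have "card (A \<union> (B - {v})) = card A + card (B - {v})"
      using fin s(2) by (intro card_Un_disjoint) auto
    moreover have "card B = card (B - {v}) + 1" using fin(2) v by (metis Suc_eq_plus1 card_Suc_Diff1)
    moreover have "card A = 5" using card_five_cycle s(5) by metis
    ultimately show ?thesis by linarith
  qed
  show "deg_in E V v \<le> card B" if "v \<in> C"
  proof -
    have "{u \<in> V. (v, u) \<in> E} \<subseteq> B" unfolding s(1) using s(8)[OF that] by auto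
    then show ?thesis unfolding deg_in_def using fin(2) by (intro card_mono)
  qed
qed

text \<open>The degrees split the vertices at \<open>chi E V - 1\<close>: those above form the clique and those below
  the stable set. In the other direction this works because the vertices of the five-cycle have degree
  \<open>card B + 2\<close>, those of \<open>B\<close> have more neighbours and those of \<open>C\<close> have fewer.\<close>

theorem NG_extremal_five_cycle_iff:
  assumes "finite V" "sym E" "irrefl E" "V \<noteq> {}"
  shows "NG_extremal E V \<and> five_cycle E {v \<in> V. deg_in E V v = chi E V - 1}
    \<longleftrightarrow> (\<exists>A B C. C5_split E V A B C)"
proof
  assume *: "NG_extremal E V \<and> five_cycle E {v \<in> V. deg_in E V v = chi E V - 1}"
  let ?A = "{v \<in> V. deg_in E V v = chi E V - 1}"
  let ?B = "{v \<in> V. chi E V - 1 < deg_in E V v}"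
  let ?C = "{v \<in> V. deg_in E V v < chi E V - 1}"
  have pos: "chi E V > 0" using chi_pos assms(1,3,4) by metis
  have "(b, u) \<in> E" if "b \<in> ?B" "u \<in> ?A \<union> ?B" "u \<noteq> b" for b u
  proof (rule NG_extremal_adjacent)
    show "chi E V \<le> deg_in E V b" "chi E V - 1 \<le> deg_in E V u" using that pos by auto
  qed (use * assms that in auto)
  moreover have "(c, u) \<notin> E" if "c \<in> ?C" "u \<in> ?A \<union> ?C" for c u
  proof (rule NG_extremal_nonadjacent)
    show "deg_in E V c < chi E V - 1" "deg_in E V u \<le> chi E V - 1" using that by auto
  qed (use * assms that in auto)
  moreover have "V = ?A \<union> ?B \<union> ?C" by auto
  moreover have "?A \<inter> ?B = {}" "?A \<inter> ?C = {}" "?B \<inter> ?C = {}" by auto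
  ultimately have "C5_split E V ?A ?B ?C" unfolding C5_split_def using * by blast
  then show "\<exists>A B C. C5_split E V A B C" by blast
next
  assume "\<exists>A B C. C5_split E V A B C"
  then obtain A B C where sp: "C5_split E V A B C" by blast
  note s = C5_splitD[OF sp assms(2)]
  have fin: "finite A" "finite B" "finite C" using assms(1) unfolding s(1) by auto
  have chi: "chi E V = card B + 3" using chi_C5_split sp assms by metis
  have chi': "chi (co E) V = card C + 3"
    using chi_C5_split[of V "co E" A C B] C5_split_co[OF _ sp] assms
    by (simp add: sym_co irrefl_co)
  have "card V = card A + card B + card C"
    unfolding s(1) using s(2,3,4) fin by (simp add: card_Un_disjoint Int_Un_distrib2)
  then have "NG_extremal E V"
    using chi chi' card_five_cycle[OF s(5)] by (simp add: NG_extremal_def)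
  moreover have "v \<in> A \<longleftrightarrow> deg_in E V v = chi E V - 1" if "v \<in> V" for v
  proof -
    have "v \<in> A \<or> v \<in> B \<or> v \<in> C" using that unfolding s(1) by simp
    moreover have "v \<notin> A" if "v \<in> B \<or> v \<in> C" using that s(2,3) by blast
    ultimately consider "v \<in> A" | "v \<in> B" "v \<notin> A" | "v \<in> C" "v \<notin> A" by metis
    then show ?thesis
    proof cases
      case 1 then show ?thesis using deg_in_C5_split(1)[OF assms(1,2,3) sp] chi by simp
    next
      case 2 then show ?thesis using deg_in_C5_split(2)[OF assms(1,2,3) sp, of v] chi by simp
    next
      case 3 then show ?thesis using deg_in_C5_split(3)[OF assms(1,2,3) sp, of v] chi by simp
    qed
  qed
  moreover have "A \<subseteq> V" unfolding s(1) by blast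
  ultimately have "{v \<in> V. deg_in E V v = chi E V - 1} = A" "NG_extremal E V" by auto
  then show "NG_extremal E V \<and> five_cycle E {v \<in> V. deg_in E V v = chi E V - 1}"
    using s(5) by simp
qed

section \<open>Row and column lengths of Ferrers diagrams\<close>

lemma filter_upt_downclosed:
  assumes "\<And>i j. 1 \<le> i \<Longrightarrow> i \<le> j \<Longrightarrow> j \<le> n \<Longrightarrow> P j \<Longrightarrow> P i"
  shows "filter P [1..<n + 1] = [1..<length (filter P [1..<n + 1]) + 1]"
  using assms
proof (induction n)
  case 0
  then show ?case by simp
next
  case (Suc n)
  show ?case
  proof (cases "P (Suc n)")
    case True
    then have "\<forall>i\<in>set [1..<Suc n + 1]. P i" using Suc.prems[of _ "Suc n"] by auto
    then have "filter P [1..<Suc n + 1] = [1..<Suc n + 1]" by (simp only: filter_True)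
    then show ?thesis by (metis add_diff_cancel_right' length_upt)
  next
    case False
    then have "filter P [1..<Suc n + 1] = filter P [1..<n + 1]" by simp
    moreover have "filter P [1..<n + 1] = [1..<length (filter P [1..<n + 1]) + 1]"
      by (rule Suc.IH) (metis Suc.prems le_SucI)
    ultimately show ?thesis by metis
  qed
qed

lemma filter_upt_initial:
  assumes "k \<le> n" "\<And>i. 1 \<le> i \<Longrightarrow> i \<le> n \<Longrightarrow> P i \<longleftrightarrow> i \<le> k"
  shows "filter P [1..<n + 1] = [1..<k + 1]"
proof -
  have "[1..<n + 1] = [1..<k + 1] @ [k + 1..<n + 1]"
    using upt_add_eq_append[of 1 "k + 1" "n - k"] assms(1) by simp
  moreover have "filter P [1..<k + 1] = [1..<k + 1]"
    using assms by (intro filter_True) auto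
  moreover have "filter P [k + 1..<n + 1] = []"
    using assms(2) by (auto simp: filter_empty_conv)
  ultimately show ?thesis by simp
qed

lemma column_length_conv_length_filter:
  "column_length ds j = length (filter ((\<le>) j) ds)"
proof -
  have "{i \<in> {1..length ds}. j \<le> ds ! (i - 1)} = Suc ` {i. i < length ds \<and> j \<le> ds ! i}"
  proof (intro set_eqI iffI)
    fix i assume "i \<in> {i \<in> {1..length ds}. j \<le> ds ! (i - 1)}"
    then have "i = Suc (i - 1)" "i - 1 \<in> {i. i < length ds \<and> j \<le> ds ! i}" by auto
    then show "i \<in> Suc ` {i. i < length ds \<and> j \<le> ds ! i}" by (rule image_eqI)
  qed auto
  then show ?thesis
    by (simp add: column_length_def length_filter_conv_card card_image)
qed

lemma column_length_antimono: "i \<le> j \<Longrightarrow> column_length ds j \<le> column_length ds i"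
  unfolding column_length_def by (intro card_mono) auto

lemma column_length_le: "column_length ds j \<le> length ds"
  unfolding column_length_conv_length_filter by (rule length_filter_le)

text \<open>The cell in row \<open>i + 1\<close> and column \<open>j\<close> is reached along its row exactly if it is reached
  down its column.\<close>

lemma nth_ge_iff_column_length:
  assumes "sorted_wrt (\<ge>) ds" "i < length ds"
  shows "j \<le> ds ! i \<longleftrightarrow> i < column_length ds j"
  using assms
proof (induction ds arbitrary: i)
  case Nil
  then show ?case by simp
next
  case (Cons d ds)
  have small: "filter ((\<le>) j) ds = []" if "\<not> j \<le> d"
    using Cons.prems(1) that by (fastforce simp: filter_empty_conv)
  show ?case
  proof (cases i)
    case 0
    then show ?thesis using small by (auto simp: column_length_conv_length_filter)
  next
    case (Suc k)
    have "j \<le> ds ! k \<Longrightarrow> j \<le> d" using Cons.prems Suc by (fastforce dest: nth_mem)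
    then show ?thesis
      using Cons Suc small by (auto simp: column_length_conv_length_filter)
  qed
qed

lemma alpha_part_conv:
  assumes "sorted_wrt (\<ge>) ds"
  shows "alpha_part ds = map (\<lambda>i. ds ! (i - 1) - i + 1) [1..<length (alpha_part ds) + 1]"
proof -
  have "filter (\<lambda>i. i \<le> ds ! (i - 1)) [1..<length ds + 1]
    = [1..<length (filter (\<lambda>i. i \<le> ds ! (i - 1)) [1..<length ds + 1]) + 1]"
  proof (rule filter_upt_downclosed)
    fix i j assume *: "1 \<le> i" "i \<le> j" "j \<le> length ds" "j \<le> ds ! (j - 1)"
    then have "j - 1 < column_length ds j" using nth_ge_iff_column_length[OF assms] by simp
    then have "i - 1 < column_length ds i" using column_length_antimono[of i j ds] * by linarith
    then show "i \<le> ds ! (i - 1)" using nth_ge_iff_column_length[OF assms, of "i - 1" i] * by simp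
  qed
  then show ?thesis unfolding alpha_part_def by (metis (no_types, lifting) length_map)
qed

lemma beta_part_conv:
  "beta_part ds = map (\<lambda>j. column_length ds j - j) [1..<length (beta_part ds) + 1]"
proof -
  have "filter (\<lambda>j. j < column_length ds j) [1..<length ds + 1]
    = [1..<length (filter (\<lambda>j. j < column_length ds j) [1..<length ds + 1]) + 1]"
  proof (rule filter_upt_downclosed)
    show "i < column_length ds i" if "i \<le> j" "j < column_length ds j" for i j
      using column_length_antimono[of i j ds] that by linarith
  qed
  then show ?thesis unfolding beta_part_def by (metis (no_types, lifting) length_map)
qed

lemma suffix_map_upt:
  "suffix [x, y] (map f [1..<p + 3]) \<longleftrightarrow> f (p + 1) = x \<and> f (p + 2) = y"
proof -
  have "[1..<p + 3] = [1..<p + 1] @ [p + 1, p + 2]"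
    by (simp add: upt_rec[of "p + 1"] upt_conv_Cons numeral_eq_Suc)
  then have "map f [1..<p + 3] = map f [1..<p + 1] @ [f (p + 1), f (p + 2)]"
    by (simp only: map_append list.map)
  then show ?thesis unfolding suffix_def by auto
qed

text \<open>When the columns \<open>p + 1\<close> and \<open>p + 2\<close> end in row \<open>p + 5\<close> and column \<open>p + 3\<close>
  ends in row \<open>p\<close> or before, the diagram has a Durfee square of size \<open>p + 2\<close>, followed by three more
  rows of length \<open>p + 2\<close>.\<close>

lemma parts_of_columns:
  assumes ds: "sorted_wrt (\<ge>) ds"
    and p: "column_length ds (p + 1) = p + 5" "column_length ds (p + 2) = p + 5"
       "column_length ds (p + 3) \<le> p"
  shows "alpha_part ds = map (\<lambda>i. ds ! (i - 1) - i + 1) [1..<p + 3]"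
    and "beta_part ds = map (\<lambda>j. column_length ds j - j) [1..<p + 3]"
    and "i < p + 5 \<Longrightarrow> p + 2 \<le> ds ! i"
    and "p \<le> i \<Longrightarrow> i < p + 5 \<Longrightarrow> ds ! i = p + 2"
    and "i \<le> p + 2 \<Longrightarrow> p + 5 \<le> column_length ds i"
    and "p + 5 \<le> length ds"
proof -
  show len: "p + 5 \<le> length ds" using p(1) column_length_le[of ds "p + 1"] by simp
  have low: "p + 5 \<le> column_length ds i" if "i \<le> p + 2" for i
    using column_length_antimono[OF that, of ds] p(2) by simp
  have high: "column_length ds i \<le> p" if "p + 3 \<le> i" for i
    using column_length_antimono[OF that, of ds] p(3) by simp
  show "p + 5 \<le> column_length ds i" if "i \<le> p + 2" using low that .
  have "filter (\<lambda>i. i \<le> ds ! (i - 1)) [1..<length ds + 1] = [1..<p + 2 + 1]"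
  proof (rule filter_upt_initial)
    fix i assume i: "1 \<le> i" "i \<le> length ds"
    then have "i \<le> ds ! (i - 1) \<longleftrightarrow> i - 1 < column_length ds i"
      using nth_ge_iff_column_length[OF ds, of "i - 1" i] by simp
    then show "i \<le> ds ! (i - 1) \<longleftrightarrow> i \<le> p + 2"
      using low[of i] high[of i] i by linarith
  qed (use len in simp)
  then show "alpha_part ds = map (\<lambda>i. ds ! (i - 1) - i + 1) [1..<p + 3]"
    unfolding alpha_part_def by (simp add: numeral_eq_Suc)
  have "filter (\<lambda>j. j < column_length ds j) [1..<length ds + 1] = [1..<p + 2 + 1]"
  proof (rule filter_upt_initial)
    show "j < column_length ds j \<longleftrightarrow> j \<le> p + 2" for j
      using low[of j] high[of j] by linarith
  qed (use len in simp)
  then show "beta_part ds = map (\<lambda>j. column_length ds j - j) [1..<p + 3]"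
    unfolding beta_part_def by (simp add: numeral_eq_Suc)
  show ge: "p + 2 \<le> ds ! i" if "i < p + 5" for i
    using nth_ge_iff_column_length[OF ds, of i "p + 2"] p(2) that len by simp
  show "ds ! i = p + 2" if "p \<le> i" "i < p + 5" for i
  proof -
    have "\<not> p + 3 \<le> ds ! i"
      using nth_ge_iff_column_length[OF ds, of i "p + 3"] that p(3) len by simp
    then show ?thesis using ge[OF that(2)] by simp
  qed
qed

text \<open>If both partitions have \<open>p + 2\<close> parts, their last two parts give the lengths of rows
  and columns \<open>p + 1\<close> and \<open>p + 2\<close>; a row length in turn says between which columns the row ends.\<close>

lemma smallest_parts_iff:
  assumes ds: "sorted_wrt (\<ge>) ds"
  shows "suffix [2, 1] (alpha_part ds) \<and> suffix [4, 3] (beta_part ds) \<and>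
      length (alpha_part ds) = length (beta_part ds) \<longleftrightarrow>
    (\<exists>p. column_length ds (p + 1) = p + 5 \<and> column_length ds (p + 2) = p + 5 \<and>
       column_length ds (p + 3) \<le> p)"
  (is "?L \<longleftrightarrow> (\<exists>p. ?R p)")
proof
  assume L: ?L
  then have "2 \<le> length (alpha_part ds)" by (auto simp: suffix_def)
  then obtain p where p: "length (alpha_part ds) = p + 2" using le_Suc_ex by (metis add.commute)
  have a: "alpha_part ds = map (\<lambda>i. ds ! (i - 1) - i + 1) [1..<p + 3]"
    using alpha_part_conv[OF ds] unfolding p by (simp add: numeral_eq_Suc)
  have "length (beta_part ds) = p + 2" using L p by simp
  then have b: "beta_part ds = map (\<lambda>j. column_length ds j - j) [1..<p + 3]"
    using beta_part_conv[of ds] by (simp add: numeral_eq_Suc)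
  have "suffix [2, 1] (alpha_part ds)" using L by simp
  then have "ds ! (p + 1 - 1) - (p + 1) + 1 = 2"
    unfolding a suffix_map_upt by (rule conjunct1)
  then have d: "ds ! p = p + 2" by simp
  have "suffix [4, 3] (beta_part ds)" using L by simp
  then have "column_length ds (p + 1) - (p + 1) = 4 \<and> column_length ds (p + 2) - (p + 2) = 3"
    unfolding b suffix_map_upt .
  then have c: "column_length ds (p + 1) = p + 5" "column_length ds (p + 2) = p + 5" by linarith+
  have "p < length ds" using c(1) column_length_le[of ds "p + 1"] by simp
  then have "column_length ds (p + 3) \<le> p"
    using nth_ge_iff_column_length[OF ds, of p "p + 3"] d by simp
  then show "\<exists>p. ?R p" using c by blast
next
  assume "\<exists>p. ?R p"
  then obtain p where p: "column_length ds (p + 1) = p + 5" "column_length ds (p + 2) = p + 5"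
    "column_length ds (p + 3) \<le> p" by blast
  note parts = parts_of_columns[OF ds p]
  have "suffix [2, 1] (alpha_part ds)"
    unfolding parts(1) suffix_map_upt using parts(4)[of p] parts(4)[of "p + 1"] by simp
  moreover have "suffix [4, 3] (beta_part ds)" unfolding parts(2) suffix_map_upt using p by simp
  moreover have "length (alpha_part ds) = length (beta_part ds)" unfolding parts(1,2) by simp
  ultimately show ?L by simp
qed

lemma sum_list_take_map_upt:
  assumes "m \<le> p"
  shows "sum_list (take m (map f [1..<p + 1])) = (\<Sum>i = 1..m. f i :: nat)"
proof -
  have "take m [1..<p + 1] = [1..<m + 1]" using assms take_upt[of 1 m "p + 1"] by simp
  then have "take m (map f [1..<p + 1]) = map f [1..<m + 1]" by (simp only: take_map)
  then have "sum_list (take m (map f [1..<p + 1])) = sum f (set [1..<m + 1])"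
    by (metis interv_sum_list_conv_sum_set_nat)
  also have "set [1..<m + 1] = {1..m}" by auto
  finally show ?thesis .
qed

lemma sum_list_take_nth:
  assumes "m \<le> length ds"
  shows "sum_list (take m ds) = (\<Sum>i = 1..m. ds ! (i - 1) :: nat)"
  using assms
proof (induction m)
  case (Suc m)
  then show ?case by (simp add: take_Suc_conv_app_nth)
qed simp

text \<open>The shifts by the row and column indices cancel, so the majorization compares row sums,
  increased by one for each row, with column sums.\<close>

lemma majorizes_iff:
  assumes ds: "sorted_wrt (\<ge>) ds"
    and p: "column_length ds (p + 1) = p + 5" "column_length ds (p + 2) = p + 5"
       "column_length ds (p + 3) \<le> p"
  shows "drop_smallest_two (beta_part ds) majorizes drop_smallest_two (alpha_part ds) \<longleftrightarrow>
    sum_list (take p ds) + p = (\<Sum>j = 1..p. column_length ds j) \<and>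
    (\<forall>m\<le>p. sum_list (take m ds) + m \<le> (\<Sum>j = 1..m. column_length ds j))"
proof -
  note parts = parts_of_columns[OF ds p]
  have drop: "drop_smallest_two (map f [1..<p + 3]) = map f [1..<p + 1]" for f :: "nat \<Rightarrow> nat"
    unfolding drop_smallest_two_def by (simp add: take_map)
  have a: "(\<Sum>i = 1..m. ds ! (i - 1) - i + 1) + (\<Sum>i = 1..m. i) = sum_list (take m ds) + m"
    if m: "m \<le> p" for m
  proof -
    have "(\<Sum>i = 1..m. ds ! (i - 1) - i + 1) + (\<Sum>i = 1..m. i) = (\<Sum>i = 1..m. ds ! (i - 1) + 1)"
      unfolding sum.distrib[symmetric]
    proof (rule sum.cong)
      fix i assume "i \<in> {1..m}"
      then have "i - 1 < p + 5" "i \<le> p" using m by auto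
      then have "i \<le> ds ! (i - 1)" using parts(3)[of "i - 1"] by linarith
      then show "ds ! (i - 1) - i + 1 + i = ds ! (i - 1) + 1" by simp
    qed simp
    also have "\<dots> = (\<Sum>i = 1..m. ds ! (i - 1)) + (\<Sum>i = 1..m. 1)" by (rule sum.distrib)
    also have "\<dots> = sum_list (take m ds) + m"
      using m parts(6) sum_list_take_nth[of m ds] by simp
    finally show ?thesis .
  qed
  have b: "(\<Sum>j = 1..m. column_length ds j - j) + (\<Sum>j = 1..m. j) = (\<Sum>j = 1..m. column_length ds j)"
    if m: "m \<le> p" for m
    unfolding sum.distrib[symmetric]
  proof (rule sum.cong)
    fix j assume "j \<in> {1..m}"
    then show "column_length ds j - j + j = column_length ds j" using parts(5)[of j] m by simp
  qed simp
  let ?a = "map (\<lambda>i. ds ! (i - 1) - i + 1) [1..<p + 1]"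
  let ?b = "map (\<lambda>j. column_length ds j - j) [1..<p + 1]"
  have a': "sum_list (take m ?a) + (\<Sum>i = 1..m. i) = sum_list (take m ds) + m" if "m \<le> p" for m
    using a[OF that] sum_list_take_map_upt[OF that] by simp
  have b': "sum_list (take m ?b) + (\<Sum>i = 1..m. i) = (\<Sum>j = 1..m. column_length ds j)" if "m \<le> p" for m
    using b[OF that] sum_list_take_map_upt[OF that] by simp
  have tot: "sum_list ?a = sum_list (take p ?a)" "sum_list ?b = sum_list (take p ?b)" by simp_all
  have le: "sum_list (take m ?a) \<le> sum_list (take m ?b) \<longleftrightarrow>
      sum_list (take m ds) + m \<le> (\<Sum>j = 1..m. column_length ds j)" if "m \<le> p" for m
    using a'[OF that] b'[OF that] by linarith
  have eq: "sum_list ?b = sum_list ?a \<longleftrightarrow> sum_list (take p ds) + p = (\<Sum>j = 1..p. column_length ds j)"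
    unfolding tot using a'[of p] b'[of p] by linarith
  have min: "min (length ?b) (length ?a) = p" by simp
  have "(\<forall>m\<le>p. sum_list (take m ?a) \<le> sum_list (take m ?b)) \<longleftrightarrow>
      (\<forall>m\<le>p. sum_list (take m ds) + m \<le> (\<Sum>j = 1..m. column_length ds j))"
    using le by blast
  then show ?thesis
    unfolding parts(1,2) drop majorizes_def min eq by (rule conj_cong[OF refl])
qed

section \<open>The Erdos-Gallai inequality and its equality case\<close>

text \<open>Both sides count the cells in the first \<open>m\<close> columns of the Ferrers diagram of \<open>d\<close>.\<close>

lemma sum_card_ge_eq_sum_min:
  assumes "finite V"
  shows "(\<Sum>j = 1..m. card {v \<in> V. j \<le> d v}) = (\<Sum>v\<in>V. min (d v) m)"
proof -
  have "(\<Sum>j = 1..m. card {v \<in> V. j \<le> d v}) = (\<Sum>v\<in>V. card {j \<in> {1..m}. j \<le> d v})"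
    using assms by (intro sum_multicount_gen) auto
  also have "\<dots> = (\<Sum>v\<in>V. card {1..min (d v) m})"
    by (intro sum.cong refl arg_cong[of _ _ card]) auto
  finally show ?thesis by simp
qed

lemma sum_deg_in_plus_card:
  assumes "finite V" "sym E" "S \<subseteq> V"
  shows "(\<Sum>v\<in>S. deg_in E V v) + card S = (\<Sum>u\<in>V. deg_in E S u + of_bool (u \<in> S))"
proof -
  have fin: "finite S" using assms(1,3) finite_subset by metis
  have "(v, u) \<in> E \<longleftrightarrow> (u, v) \<in> E" for u v using assms(2) by (auto simp: sym_def)
  then have "{v \<in> S. (v, u) \<in> E} = {v \<in> S. (u, v) \<in> E}" for u by simp
  then have "\<forall>u\<in>V. card {v \<in> S. (v, u) \<in> E} = deg_in E S u" by (simp add: deg_in_def)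
  then have "(\<Sum>v\<in>S. deg_in E V v) = (\<Sum>u\<in>V. deg_in E S u)"
    unfolding deg_in_def[of E V] using fin assms(1) by (intro sum_multicount_gen)
  moreover have "card S = (\<Sum>u\<in>V. of_bool (u \<in> S))"
    using assms(1,3) by (simp add: Int_absorb1)
  ultimately show ?thesis by (simp add: sum.distrib)
qed

text \<open>A vertex of \<open>S\<close> is not its own neighbour and so has at most \<open>card S - 1\<close> neighbours in \<open>S\<close>.
  Counting it as one more gives the same bound for the vertices inside and outside \<open>S\<close>.\<close>

lemma deg_in_plus_le_min:
  assumes "finite V" "irrefl E" "S \<subseteq> V" "u \<in> V" "\<forall>v\<in>S. card S \<le> deg_in E V v"
  shows "deg_in E S u + of_bool (u \<in> S) \<le> min (deg_in E V u) (card S)"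
proof (cases "u \<in> S")
  have fin: "finite S" using assms(1,3) finite_subset by metis
  case True
  have "{v \<in> S. (u, v) \<in> E} \<subseteq> S - {u}" using assms(2) by (auto simp: irrefl_def)
  then have "deg_in E S u \<le> card (S - {u})" unfolding deg_in_def using fin by (intro card_mono) auto
  moreover have "card (S - {u}) + 1 = card S" using card_Suc_Diff1[OF fin True] by simp
  ultimately show ?thesis using True assms(5) by fastforce
next
  have fin: "finite S" using assms(1,3) finite_subset by metis
  case False
  have "deg_in E S u \<le> card S" unfolding deg_in_def using fin by (intro card_mono) auto
  moreover have "deg_in E S u \<le> deg_in E V u"
    unfolding deg_in_def using assms(1,3) by (intro card_mono) auto
  ultimately show ?thesis using False by simp
qed

lemma Erdos_Gallai:
  assumes "finite V" "sym E" "irrefl E" "S \<subseteq> V" "\<forall>v\<in>S. card S \<le> deg_in E V v"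
  shows "(\<Sum>v\<in>S. deg_in E V v) + card S \<le> (\<Sum>v\<in>V. min (deg_in E V v) (card S))"
  unfolding sum_deg_in_plus_card[OF assms(1,2,4)]
  by (rule sum_mono) (rule deg_in_plus_le_min[OF assms(1,3,4) _ assms(5)])

lemma Erdos_Gallai_eq_iff:
  assumes "finite V" "sym E" "irrefl E" "S \<subseteq> V" "\<forall>v\<in>S. card S \<le> deg_in E V v"
  shows "(\<Sum>v\<in>S. deg_in E V v) + card S = (\<Sum>v\<in>V. min (deg_in E V v) (card S)) \<longleftrightarrow>
    (\<forall>u\<in>V. deg_in E S u + of_bool (u \<in> S) = min (deg_in E V u) (card S))"
  unfolding sum_deg_in_plus_card[OF assms(1,2,4)]
proof (intro iffI ballI)
  assume eq: "(\<Sum>u\<in>V. deg_in E S u + of_bool (u \<in> S)) = (\<Sum>v\<in>V. min (deg_in E V v) (card S))"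
  show "deg_in E S u + of_bool (u \<in> S) = min (deg_in E V u) (card S)" if "u \<in> V" for u
    by (rule sum_mono_inv[OF eq deg_in_plus_le_min[OF assms(1,3,4) _ assms(5)] that assms(1)])
qed (rule sum.cong, simp_all)

text \<open>Vertex by vertex, equality for \<open>B\<close> says that a vertex of \<open>B\<close> is adjacent to the rest of \<open>B\<close>, that a vertex
  of \<open>A\<close> is adjacent to all of \<open>B\<close>, and that a vertex of \<open>C\<close> has all its neighbours in \<open>B\<close>. A vertex of \<open>A\<close>
  then has two neighbours left for \<open>A\<close>.\<close>

lemma C5_split_iff_Erdos_Gallai_eq:
  assumes "finite V" "sym E" "irrefl E"
    and V: "V = A \<union> B \<union> C" and disj: "A \<inter> B = {}" "A \<inter> C = {}" "B \<inter> C = {}"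
    and A: "card A = 5" "\<forall>v\<in>A. deg_in E V v = card B + 2"
    and B: "\<forall>v\<in>B. card B \<le> deg_in E V v" and C: "\<forall>v\<in>C. deg_in E V v \<le> card B"
  shows "C5_split E V A B C \<longleftrightarrow>
    (\<Sum>v\<in>B. deg_in E V v) + card B = (\<Sum>v\<in>V. min (deg_in E V v) (card B))"
proof -
  have fin: "finite A" "finite B" "finite C" using assms(1) unfolding V by auto
  have sub: "A \<subseteq> V" "B \<subseteq> V" "C \<subseteq> V" unfolding V by auto
  have ed: "(x, y) \<in> E \<Longrightarrow> (y, x) \<in> E" for x y using assms(2) by (rule symD)
  have irr: "(x, x) \<notin> E" for x using assms(3) by (auto simp: irrefl_def)
  have inA: "deg_in E B u + of_bool (u \<in> B) = min (deg_in E V u) (card B) \<longleftrightarrow> (\<forall>b\<in>B. (u, b) \<in> E)"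
    if "u \<in> A" for u
  proof -
    have "u \<notin> B" using that disj by blast
    then have "deg_in E B u + of_bool (u \<in> B) = min (deg_in E V u) (card B) \<longleftrightarrow> deg_in E B u = card B"
      using A that by simp
    also have "\<dots> \<longleftrightarrow> {b \<in> B. (u, b) \<in> E} = B"
      unfolding deg_in_def using card_subset_eq[OF fin(2), of "{b \<in> B. (u, b) \<in> E}"] by auto
    finally show ?thesis by blast
  qed
  have inB: "deg_in E B u + of_bool (u \<in> B) = min (deg_in E V u) (card B) \<longleftrightarrow>
      (\<forall>b\<in>B. b \<noteq> u \<longrightarrow> (u, b) \<in> E)"
    if "u \<in> B" for u
  proof -
    have s: "{b \<in> B. (u, b) \<in> E} \<subseteq> B - {u}" using irr by auto
    obtain k where k: "card (B - {u}) = k" by simp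
    then have "min (deg_in E V u) (card B) = Suc k"
      using B that card_Suc_Diff1[OF fin(2) that] by simp
    then have "deg_in E B u + of_bool (u \<in> B) = min (deg_in E V u) (card B) \<longleftrightarrow>
        card {b \<in> B. (u, b) \<in> E} = card (B - {u})"
      unfolding k using that by (simp add: deg_in_def[of E B])
    also have "\<dots> \<longleftrightarrow> {b \<in> B. (u, b) \<in> E} = B - {u}"
      by (rule iffI, rule card_subset_eq[OF _ s], simp add: fin, assumption, simp only:)
    finally show ?thesis using irr by blast
  qed
  have inC: "deg_in E B u + of_bool (u \<in> B) = min (deg_in E V u) (card B) \<longleftrightarrow>
      (\<forall>v\<in>A \<union> C. (u, v) \<notin> E)"
    if "u \<in> C" for u
  proof -
    have s: "{b \<in> B. (u, b) \<in> E} \<subseteq> {v \<in> V. (u, v) \<in> E}" using sub by blast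
    have "u \<notin> B" using that disj by blast
    then have "deg_in E B u + of_bool (u \<in> B) = min (deg_in E V u) (card B) \<longleftrightarrow>
        card {b \<in> B. (u, b) \<in> E} = card {v \<in> V. (u, v) \<in> E}"
      using C that by (simp add: deg_in_def)
    also have "\<dots> \<longleftrightarrow> {b \<in> B. (u, b) \<in> E} = {v \<in> V. (u, v) \<in> E}"
      by (rule iffI, rule card_subset_eq[OF _ s], simp add: assms(1), assumption, simp only:)
    also have "\<dots> \<longleftrightarrow> (\<forall>v\<in>A \<union> C. (u, v) \<notin> E)"
      unfolding V using disj by blast
    finally show ?thesis .
  qed
  have split: "(\<forall>u\<in>V. P u) \<longleftrightarrow> (\<forall>u\<in>A. P u) \<and> (\<forall>u\<in>B. P u) \<and> (\<forall>u\<in>C. P u)" for P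
    unfolding V by blast
  have eq: "(\<Sum>v\<in>B. deg_in E V v) + card B = (\<Sum>v\<in>V. min (deg_in E V v) (card B)) \<longleftrightarrow>
      (\<forall>u\<in>A. \<forall>b\<in>B. (u, b) \<in> E) \<and> (\<forall>u\<in>B. \<forall>b\<in>B. b \<noteq> u \<longrightarrow> (u, b) \<in> E) \<and>
      (\<forall>u\<in>C. \<forall>v\<in>A \<union> C. (u, v) \<notin> E)"
    unfolding Erdos_Gallai_eq_iff[OF assms(1-3) sub(2) B] split using inA inB inC by simp
  show ?thesis
  proof
    assume "C5_split E V A B C"
    note s = C5_splitD[OF this assms(2)]
    have "(u, b) \<in> E" if "u \<in> A" "b \<in> B" for u b
    proof -
      have "u \<noteq> b" using that disj by blast
      then show ?thesis using s(7)[of b u] that by simp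
    qed
    then show "(\<Sum>v\<in>B. deg_in E V v) + card B = (\<Sum>v\<in>V. min (deg_in E V v) (card B))"
      unfolding eq using s(6,8) by simp
  next
    assume "(\<Sum>v\<in>B. deg_in E V v) + card B = (\<Sum>v\<in>V. min (deg_in E V v) (card B))"
    then have *: "\<And>u b. u \<in> A \<Longrightarrow> b \<in> B \<Longrightarrow> (u, b) \<in> E"
      "\<And>u b. u \<in> B \<Longrightarrow> b \<in> B \<Longrightarrow> b \<noteq> u \<Longrightarrow> (u, b) \<in> E"
      "\<And>u v. u \<in> C \<Longrightarrow> v \<in> A \<union> C \<Longrightarrow> (u, v) \<notin> E"
      unfolding eq by simp_all
    have "deg_in E A v = 2" if v: "v \<in> A" for v
    proof -
      have 1: "(v, u) \<notin> E" if "u \<in> C" for u using *(3)[of u v] that v ed[of v u] by blast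
      have "{u \<in> V. (v, u) \<in> E} = B \<union> {u \<in> A. (v, u) \<in> E}"
        unfolding V using 1 *(1)[OF v] by blast
      moreover have "card (B \<union> {u \<in> A. (v, u) \<in> E}) = card B + card {u \<in> A. (v, u) \<in> E}"
        using fin disj(1) by (intro card_Un_disjoint) auto
      ultimately have "deg_in E V v = card B + deg_in E A v" by (simp add: deg_in_def)
      then show ?thesis using A(2) v by simp
    qed
    then have "five_cycle E A" using two_regular_five_cycle[OF assms(2,3) A(1)] by blast
    moreover have "(b, u) \<in> E" if "b \<in> B" "u \<in> A \<union> B" "u \<noteq> b" for b u
      using that *(2)[of b u] ed[OF *(1)[of u b]] by blast
    ultimately show "C5_split E V A B C"
      unfolding C5_split_def using V disj *(3) by blast
  qed
qed

section \<open>The degree sequence of such a graph\<close>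

lemma column_length_map:
  assumes "distinct vs"
  shows "column_length (map d vs) j = card {v \<in> set vs. j \<le> d v}"
proof -
  have "column_length (map d vs) j = length (filter (\<lambda>v. j \<le> d v) vs)"
    by (simp add: column_length_conv_length_filter filter_map o_def)
  also have "\<dots> = card (set (filter (\<lambda>v. j \<le> d v) vs))"
    using assms by (intro distinct_card[symmetric]) simp
  finally show ?thesis by simp
qed

text \<open>For a given partition, \<open>p\<close> is the size of \<open>B\<close>. The first \<open>p\<close> vertices, being those of degree at least
  \<open>p + 3\<close>, are the vertices of \<open>B\<close>, and every initial segment of them satisfies the hypothesis of
  the Erdos-Gallai inequality. Conversely, the first \<open>p\<close> vertices, the next five and the rest are \<open>B\<close>,
  \<open>A\<close> and \<open>C\<close>. At first the vertices of \<open>B\<close> are only known to have degree at least \<open>p + 2\<close>, so \<open>B\<close>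
  is chosen by position in the sequence and not by degree.\<close>

theorem C5_split_iff_column_lengths:
  assumes fin: "finite V" and graph: "sym E" "irrefl E" and vs: "distinct vs" "set vs = V"
    and ds: "ds = map (deg_in E V) vs" "sorted_wrt (\<ge>) ds"
  shows "(\<exists>A B C. C5_split E V A B C) \<longleftrightarrow>
    (\<exists>p. (column_length ds (p + 1) = p + 5 \<and> column_length ds (p + 2) = p + 5 \<and>
        column_length ds (p + 3) \<le> p) \<and>
      sum_list (take p ds) + p = (\<Sum>j = 1..p. column_length ds j) \<and>
      (\<forall>m\<le>p. sum_list (take m ds) + m \<le> (\<Sum>j = 1..m. column_length ds j)))"
proof -
  let ?d = "deg_in E V"
  have len: "length ds = length vs" using ds(1) by simp
  have nth: "ds ! i = ?d (vs ! i)" if "i < length vs" for i using that ds(1) by simp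
  have col: "column_length ds j = card {v \<in> V. j \<le> ?d v}" for j
    using column_length_map[OF vs(1)] vs(2) ds(1) by simp
  have cols: "(\<Sum>j = 1..m. column_length ds j) = (\<Sum>v\<in>V. min (?d v) m)" for m
    unfolding col by (rule sum_card_ge_eq_sum_min[OF fin])
  have top: "sum_list (take m ds) = (\<Sum>v\<in>set (take m vs). ?d v)" for m
    unfolding ds(1) take_map by (rule sum_list_distinct_conv_sum_set) (simp add: vs(1))
  have cardtop: "card (set (take m vs)) = m" if "m \<le> length vs" for m
    using distinct_card[of "take m vs"] vs(1) that by simp
  have subtop: "set (take m vs) \<subseteq> V" for m using vs(2) set_take_subset by metis
  have degtop: "j \<le> ?d v" if v: "v \<in> set (take m vs)" and m: "m \<le> column_length ds j" for j m v
  proof -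
    obtain i where i: "i < length vs" "i < m" "v = vs ! i"
      using v by (auto simp: in_set_conv_nth)
    then show ?thesis
      using nth_ge_iff_column_length[OF ds(2), of i j] m nth len by simp
  qed
  have lens: "column_length ds j \<le> length vs" for j using column_length_le[of ds j] len by simp
  show ?thesis
  proof
    assume "\<exists>A B C. C5_split E V A B C"
    then obtain A B C where sp: "C5_split E V A B C" by blast
    note s = C5_splitD[OF sp graph(1)]
    note deg = deg_in_C5_split[OF fin graph sp]
    let ?p = "card B"
    have finAB: "finite A" "finite B" using fin unfolding s(1) by auto
    have cases: "v \<in> A \<or> v \<in> B \<or> v \<in> C" if "v \<in> V" for v using that unfolding s(1) by blast
    have sub: "A \<subseteq> V" "B \<subseteq> V" unfolding s(1) by auto
    have AB: "{v \<in> V. j \<le> ?d v} = A \<union> B" if "?p < j" "j \<le> ?p + 2" for j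
    proof (intro set_eqI iffI)
      fix v assume "v \<in> {v \<in> V. j \<le> ?d v}"
      then have "v \<in> V" "v \<notin> C" using deg(3)[of v] that by auto
      then show "v \<in> A \<union> B" using cases by blast
    next
      fix v assume v: "v \<in> A \<union> B"
      then have "j \<le> ?d v" using deg(1,2)[of v] that by auto
      then show "v \<in> {v \<in> V. j \<le> ?d v}" using v sub by blast
    qed
    have B: "{v \<in> V. ?p + 3 \<le> ?d v} = B"
    proof (intro set_eqI iffI)
      fix v assume "v \<in> {v \<in> V. ?p + 3 \<le> ?d v}"
      then have "v \<in> V" "v \<notin> C" "v \<notin> A" using deg(1,3)[of v] by auto
      then show "v \<in> B" using cases by blast
    next
      fix v assume v: "v \<in> B"
      then have "?p + 3 \<le> ?d v" using deg(2)[of v] by simp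
      then show "v \<in> {v \<in> V. ?p + 3 \<le> ?d v}" using v sub by blast
    qed
    have "card (A \<union> B) = ?p + 5"
      using card_Un_disjoint[OF finAB s(2)] card_five_cycle[OF s(5)] by simp
    then have c: "column_length ds (?p + 1) = ?p + 5" "column_length ds (?p + 2) = ?p + 5"
      "column_length ds (?p + 3) = ?p"
      unfolding col using AB[of "?p + 1"] AB[of "?p + 2"] B by simp_all
    have plen: "?p \<le> length vs" using lens[of "?p + 3"] c(3) by simp
    have le: "sum_list (take m ds) + m \<le> (\<Sum>j = 1..m. column_length ds j)" if m: "m \<le> ?p" for m
    proof -
      have cm: "card (set (take m vs)) = m" using cardtop m plen by simp
      have "\<forall>v\<in>set (take m vs). card (set (take m vs)) \<le> ?d v"
        using degtop[of _ m "?p + 3"] c(3) m unfolding cm by fastforce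
      from Erdos_Gallai[OF fin graph subtop this] show ?thesis
        unfolding top cols cm .
    qed
    have "set (take ?p vs) \<subseteq> {v \<in> V. ?p + 3 \<le> ?d v}"
      using degtop[of _ ?p "?p + 3"] c(3) subtop[of ?p] by auto
    then have "set (take ?p vs) \<subseteq> B" unfolding B .
    then have "set (take ?p vs) = B"
      using card_subset_eq[OF finAB(2)] cardtop[OF plen] by blast
    moreover have "sum ?d B + ?p = (\<Sum>v\<in>V. min (?d v) ?p)"
    proof (rule iffD1[OF C5_split_iff_Erdos_Gallai_eq sp])
      show "\<forall>v\<in>B. ?p \<le> ?d v" using deg(2) by fastforce
    qed (use fin graph s(1-4) card_five_cycle[OF s(5)] deg(1,3) in blast)+
    ultimately have "sum_list (take ?p ds) + ?p = (\<Sum>j = 1..?p. column_length ds j)"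
      unfolding top cols by simp
    then show "\<exists>p. (column_length ds (p + 1) = p + 5 \<and> column_length ds (p + 2) = p + 5 \<and>
          column_length ds (p + 3) \<le> p) \<and>
        sum_list (take p ds) + p = (\<Sum>j = 1..p. column_length ds j) \<and>
        (\<forall>m\<le>p. sum_list (take m ds) + m \<le> (\<Sum>j = 1..m. column_length ds j))"
      using c le by (intro exI[of _ ?p]) simp
  next
    assume "\<exists>p. (column_length ds (p + 1) = p + 5 \<and> column_length ds (p + 2) = p + 5 \<and>
        column_length ds (p + 3) \<le> p) \<and>
      sum_list (take p ds) + p = (\<Sum>j = 1..p. column_length ds j) \<and>
      (\<forall>m\<le>p. sum_list (take m ds) + m \<le> (\<Sum>j = 1..m. column_length ds j))"
    then obtain p where c: "column_length ds (p + 1) = p + 5" "column_length ds (p + 2) = p + 5"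
        "column_length ds (p + 3) \<le> p"
      and total: "sum_list (take p ds) + p = (\<Sum>j = 1..p. column_length ds j)" by blast
    note parts = parts_of_columns[OF ds(2) c]
    let ?A = "set (take 5 (drop p vs))" and ?B = "set (take p vs)" and ?C = "set (drop (p + 5) vs)"
    have plen: "p + 5 \<le> length vs" using parts(6) len by simp
    have "vs = take p vs @ take 5 (drop p vs) @ drop (p + 5) vs"
      by (metis add.commute append_take_drop_id drop_drop)
    note app = this
    have dist: "distinct (take p vs @ take 5 (drop p vs) @ drop (p + 5) vs)" using app vs(1) by metis
    have V: "V = ?A \<union> ?B \<union> ?C"
      unfolding vs(2)[symmetric] by (subst app) auto
    have disj: "?A \<inter> ?B = {}" "?A \<inter> ?C = {}" "?B \<inter> ?C = {}" using dist by auto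
    have cB: "card ?B = p" using cardtop plen by simp
    have cA: "card ?A = 5" using distinct_card[of "take 5 (drop p vs)"] vs(1) plen by simp
    have dA: "?d v = p + 2" if v: "v \<in> ?A" for v
    proof -
      obtain k where k: "k < 5" "v = take 5 (drop p vs) ! k"
        using v plen by (auto simp: in_set_conv_nth)
      then have "v = vs ! (p + k)" using plen by simp
      then show ?thesis using parts(4)[of "p + k"] nth[of "p + k"] k(1) plen by simp
    qed
    have dB: "p \<le> ?d v" if "v \<in> ?B" for v
      using degtop[OF that, of "p + 2"] c(2) by simp
    have dC: "?d v \<le> p" if v: "v \<in> ?C" for v
    proof -
      obtain k where k: "k < length vs - (p + 5)" "v = drop (p + 5) vs ! k"
        using v by (auto simp: in_set_conv_nth)
      then have "v = vs ! (p + 5 + k)" "p + 5 + k < length vs" using plen by simp_all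
      then show ?thesis
        using nth_ge_iff_column_length[OF ds(2), of "p + 5 + k" "p + 1"] nth[of "p + 5 + k"] c(1) len
        by simp
    qed
    have "sum ?d ?B + card ?B = (\<Sum>v\<in>V. min (?d v) (card ?B))"
      using total unfolding top cols cB .
    moreover have "C5_split E V ?A ?B ?C \<longleftrightarrow> sum ?d ?B + card ?B = (\<Sum>v\<in>V. min (?d v) (card ?B))"
      by (rule C5_split_iff_Erdos_Gallai_eq[OF fin graph V disj cA])
        (use dA dB dC cB in simp_all)
    ultimately show "\<exists>A B C. C5_split E V A B C" by blast
  qed
qed

section \<open>Translation to the graph notions of the theorem\<close>

lemma chromatic_number_eq_chi:
  assumes "parcs G \<subseteq> pverts G \<times> pverts G"
  shows "chromatic_number G = chi (parcs G) (pverts G)"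
proof -
  have "(\<forall>(u, v) \<in> parcs G. f u \<noteq> f v) \<longleftrightarrow>
      (\<forall>u\<in>pverts G. \<forall>v\<in>pverts G. (u, v) \<in> parcs G \<longrightarrow> f u \<noteq> f v)" for f :: "'a \<Rightarrow> nat"
    using assms by auto
  then have "colorable G k \<longleftrightarrow> (\<exists>f. proper_colouring (parcs G) (pverts G) k f)" for k
    unfolding colorable_def proper_colouring_def by simp
  then show ?thesis by (simp add: chromatic_number_def chi_def)
qed

lemma chromatic_number_compl_graph:
  "chromatic_number (compl_graph G) = chi (co (parcs G)) (pverts G)"
proof -
  have "(\<forall>(u, v) \<in> parcs (compl_graph G). f u \<noteq> f v) \<longleftrightarrow>
      (\<forall>u\<in>pverts G. \<forall>v\<in>pverts G. (u, v) \<in> co (parcs G) \<longrightarrow> f u \<noteq> f v)" for f :: "'a \<Rightarrow> nat"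
    unfolding compl_graph_def co_def by auto
  then have "colorable (compl_graph G) k \<longleftrightarrow>
      (\<exists>f. proper_colouring (co (parcs G)) (pverts G) k f)" for k
    unfolding colorable_def proper_colouring_def by (simp add: compl_graph_def)
  then show ?thesis by (simp add: chromatic_number_def chi_def)
qed

lemma deg_eq_deg_in:
  assumes "parcs G \<subseteq> pverts G \<times> pverts G"
  shows "deg G v = deg_in (parcs G) (pverts G) v"
proof -
  have "out_arcs (with_proj G) v = Pair v ` {u \<in> pverts G. (v, u) \<in> parcs G}"
    using assms by (auto simp: out_arcs_def)
  then show ?thesis
    by (simp add: out_degree_def deg_in_def card_image inj_on_def)
qed

lemma parcs_cycle_graph_5:
  "(i, j) \<in> parcs (cycle_graph 5) \<longleftrightarrow>
    i = 0 \<and> (j = 1 \<or> j = 4) \<or> i = 1 \<and> (j = 0 \<or> j = 2) \<or> i = 2 \<and> (j = 1 \<or> j = 3) \<or>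
    i = 3 \<and> (j = 2 \<or> j = 4) \<or> i = 4 \<and> (j = 3 \<or> j = 0)"
proof (cases "i < 5 \<and> j < 5")
  case True
  then have "i \<in> {0, 1, 2, 3, 4}" "j \<in> {0, 1, 2, 3, 4}" by auto
  then show ?thesis by (elim insertE emptyE) (simp_all add: cycle_graph_def)
next
  case False
  then show ?thesis by (auto simp: cycle_graph_def)
qed

lemma five_cycle_iff_bij_betw:
  assumes "sym E" "irrefl E"
  shows "five_cycle E A \<longleftrightarrow> (\<exists>g. bij_betw g A {..<5} \<and>
    (\<forall>u\<in>A. \<forall>v\<in>A. (u, v) \<in> E \<longleftrightarrow> (g u, g v) \<in> parcs (cycle_graph 5)))"
proof
  assume "five_cycle E A"
  then obtain a b c d e where A: "A = {a, b, c, d, e}" and p: "pentagon E a b c d e"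
    unfolding five_cycle_def by metis
  have q: "pentagon E a e d c b" using pentagon_reverse assms(1) p by metis
  have irr: "(x, x) \<notin> E" for x using assms(2) by (auto simp: irrefl_def)
  define g where "g x = (if x = a then 0 else if x = b then 1 else if x = c then 2
    else if x = d then 3 else (4::nat))" for x
  have g: "g a = 0" "g b = 1" "g c = 2" "g d = 3" "g e = 4"
    using p unfolding pentagon_def g_def by auto
  have five: "{..<5} = {0, 1, 2, 3, 4::nat}" by auto
  have "g ` A = {..<5}" unfolding A five using g by simp
  moreover have "inj_on g A" unfolding A inj_on_def using g by simp
  moreover have "\<forall>u\<in>A. \<forall>v\<in>A. (u, v) \<in> E \<longleftrightarrow> (g u, g v) \<in> parcs (cycle_graph 5)"
    using p q irr unfolding A pentagon_def by (simp add: g parcs_cycle_graph_5)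
  ultimately show "\<exists>g. bij_betw g A {..<5} \<and>
      (\<forall>u\<in>A. \<forall>v\<in>A. (u, v) \<in> E \<longleftrightarrow> (g u, g v) \<in> parcs (cycle_graph 5))"
    unfolding bij_betw_def by blast
next
  assume "\<exists>g. bij_betw g A {..<5} \<and>
    (\<forall>u\<in>A. \<forall>v\<in>A. (u, v) \<in> E \<longleftrightarrow> (g u, g v) \<in> parcs (cycle_graph 5))"
  then obtain g where g: "bij_betw g A {..<5}"
    and E: "\<And>u v. u \<in> A \<Longrightarrow> v \<in> A \<Longrightarrow> (u, v) \<in> E \<longleftrightarrow> (g u, g v) \<in> parcs (cycle_graph 5)"
    by blast
  define f where "f = inv_into A g"
  have f: "bij_betw f {..<5} A" unfolding f_def using g by (rule bij_betw_inv_into)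
  have five: "{..<5} = {0, 1, 2, 3, 4::nat}" by auto
  have "f ` {..<5} = A" using f by (rule bij_betw_imp_surj_on)
  then have A: "A = {f 0, f 1, f 2, f 3, f 4}" unfolding five by simp
  have gf: "g (f i) = i" if "i < 5" for i
    unfolding f_def using g that by (simp add: bij_betw_inv_into_right)
  have fA: "f i \<in> A" if "i < 5" for i using f that by (auto simp: bij_betw_def)
  have Ef: "(f i, f j) \<in> E \<longleftrightarrow> (i, j) \<in> parcs (cycle_graph 5)" if "i < 5" "j < 5" for i j
    using E[OF fA[OF that(1)] fA[OF that(2)]] gf that by simp
  have ff: "f i = f j \<longleftrightarrow> i = j" if "i < 5" "j < 5" for i j using gf that by metis
  have "pentagon E (f 0) (f 1) (f 2) (f 3) (f 4)"
    unfolding pentagon_def by (simp add: ff Ef parcs_cycle_graph_5)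
  then show "five_cycle E A" unfolding five_cycle_def using A by metis
qed

text \<open>An isomorphism of digraphs supplies head and tail functions for its image. Equality with
  the cycle makes them the two projections, so the map on vertices determines the map on arcs.\<close>

lemma digraph_iso_cycle_graph_5:
  "digraph_iso (with_proj G \<restriction> A) (with_proj (cycle_graph 5)) \<longleftrightarrow>
   (\<exists>g. bij_betw g A {..<5} \<and>
     (\<forall>u\<in>A. \<forall>v\<in>A. (u, v) \<in> parcs G \<longleftrightarrow> (g u, g v) \<in> parcs (cycle_graph 5)))"
proof
  let ?H = "with_proj G \<restriction> A"
  let ?a = "{e \<in> parcs G. fst e \<in> A \<and> snd e \<in> A}"
  assume "digraph_iso ?H (with_proj (cycle_graph 5))"
  then obtain h where iso: "pre_digraph.digraph_isomorphism ?H h"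
    and eq: "with_proj (cycle_graph 5) = app_iso h ?H"
    unfolding digraph_iso_def by blast
  have v: "iso_verts h ` A = {..<5}"
    using arg_cong[OF eq, of verts] by (simp add: cycle_graph_def)
  have a: "iso_arcs h ` ?a = parcs (cycle_graph 5)"
    using arg_cong[OF eq, of arcs] by simp
  have t: "iso_tail h = fst" "iso_head h = snd"
    using arg_cong[OF eq, of tail] arg_cong[OF eq, of head] by simp_all
  have inj: "inj_on (iso_verts h) A"
    using iso by (simp add: pre_digraph.digraph_isomorphism_def)
  have hom: "\<forall>e\<in>?a. iso_verts h (fst e) = fst (iso_arcs h e) \<and> iso_verts h (snd e) = snd (iso_arcs h e)"
    using iso unfolding pre_digraph.digraph_isomorphism_def t with_proj_simps
      induce_subgraph_arcs induce_subgraph_tail induce_subgraph_head by (elim conjE)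
  have ends: "iso_arcs h e = (iso_verts h (fst e), iso_verts h (snd e))" if "e \<in> ?a" for e
    using bspec[OF hom that] by (simp add: prod_eq_iff)
  have "(u, v) \<in> parcs G \<longleftrightarrow> (iso_verts h u, iso_verts h v) \<in> parcs (cycle_graph 5)"
    if uv: "u \<in> A" "v \<in> A" for u v
  proof
    assume "(u, v) \<in> parcs G"
    then have "(u, v) \<in> ?a" using uv by simp
    then show "(iso_verts h u, iso_verts h v) \<in> parcs (cycle_graph 5)"
      using a ends[of "(u, v)"] by force
  next
    assume "(iso_verts h u, iso_verts h v) \<in> parcs (cycle_graph 5)"
    then obtain e where e: "e \<in> ?a" "(iso_verts h u, iso_verts h v) = iso_arcs h e"
      unfolding a[symmetric] by blast
    then have "iso_verts h u = iso_verts h (fst e)" "iso_verts h v = iso_verts h (snd e)"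
      using ends[OF e(1)] by simp_all
    then have "u = fst e" "v = snd e" using inj e(1) uv by (auto dest: inj_onD)
    then show "(u, v) \<in> parcs G" using e(1) by simp
  qed
  then show "\<exists>g. bij_betw g A {..<5} \<and>
      (\<forall>u\<in>A. \<forall>v\<in>A. (u, v) \<in> parcs G \<longleftrightarrow> (g u, g v) \<in> parcs (cycle_graph 5))"
    using v inj unfolding bij_betw_def by blast
next
  let ?H = "with_proj G \<restriction> A"
  let ?a = "{e \<in> parcs G. fst e \<in> A \<and> snd e \<in> A}"
  assume "\<exists>g. bij_betw g A {..<5} \<and>
    (\<forall>u\<in>A. \<forall>v\<in>A. (u, v) \<in> parcs G \<longleftrightarrow> (g u, g v) \<in> parcs (cycle_graph 5))"
  then obtain g where g: "inj_on g A" "g ` A = {..<5}"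
    and E: "\<And>u v. u \<in> A \<Longrightarrow> v \<in> A \<Longrightarrow> (u, v) \<in> parcs G \<longleftrightarrow> (g u, g v) \<in> parcs (cycle_graph 5)"
    unfolding bij_betw_def by blast
  define h where "h = \<lparr> iso_verts = g, iso_arcs = map_prod g g, iso_head = snd, iso_tail = fst \<rparr>"
  have "wf_digraph ?H" by unfold_locales auto
  moreover have "inj_on (map_prod g g) ?a"
    using map_prod_inj_on[OF g(1) g(1)] by (rule inj_on_subset) auto
  ultimately have "pre_digraph.digraph_isomorphism ?H h"
    using g(1) by (simp add: pre_digraph.digraph_isomorphism_def h_def)
  moreover have "map_prod g g ` ?a = parcs (cycle_graph 5)"
  proof
    show "map_prod g g ` ?a \<subseteq> parcs (cycle_graph 5)" using E by auto
    show "parcs (cycle_graph 5) \<subseteq> map_prod g g ` ?a"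
    proof
      fix x assume x: "x \<in> parcs (cycle_graph 5)"
      then have "fst x \<in> {..<5}" "snd x \<in> {..<5}" by (auto simp: cycle_graph_def)
      then obtain u v where uv: "u \<in> A" "v \<in> A" "x = (g u, g v)"
        unfolding g(2)[symmetric] by (metis imageE prod.collapse)
      then have "(u, v) \<in> ?a" using E x by simp
      then show "x \<in> map_prod g g ` ?a" using uv(3) by force
    qed
  qed
  then have "with_proj (cycle_graph 5) = app_iso h ?H"
    using g(2) by (simp add: app_iso_def h_def with_proj_def induce_subgraph_def cycle_graph_def)
  ultimately show "digraph_iso ?H (with_proj (cycle_graph 5))" unfolding digraph_iso_def by blast
qed

lemma degree_seq_enumeration:
  assumes "finite (pverts G)"
  obtains vs where "distinct vs" "set vs = pverts G" "degree_seq G = map (deg G) vs"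
    "sorted_wrt (\<ge>) (degree_seq G)"
proof -
  obtain xs where xs: "set xs = pverts G" "distinct xs"
    using finite_distinct_list[OF assms] by blast
  let ?vs = "rev (sort_key (deg G) xs)"
  have "image_mset (deg G) (mset_set (pverts G)) = mset (map (deg G) (sort_key (deg G) xs))"
    using mset_set_set[OF xs(2)] xs(1) by simp
  then have "sorted_list_of_multiset (image_mset (deg G) (mset_set (pverts G)))
      = sort (map (deg G) (sort_key (deg G) xs))"
    by (metis sorted_list_of_multiset_mset)
  also have "\<dots> = map (deg G) (sort_key (deg G) xs)"
    by (rule sorted_sort_id) (rule sorted_sort_key)
  finally have *: "degree_seq G = rev (map (deg G) (sort_key (deg G) xs))"
    unfolding degree_seq_def by (rule arg_cong)
  show thesis
  proof (rule that)
    show "distinct ?vs" "set ?vs = pverts G" using xs by simp_all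
    show "degree_seq G = map (deg G) ?vs" unfolding * by (rule rev_map)
    show "sorted_wrt (\<ge>) (degree_seq G)"
      unfolding * sorted_wrt_rev using sorted_sort_key[of "deg G" xs] by simp
  qed
qed

theorem theorem6p1:
  fixes G :: "'a pair_pre_digraph" and \<pi> :: "nat list"
  assumes "pair_graph G"
    and "pverts G \<noteq> {}"
    and no_isolated: "\<forall>v \<in> pverts G. deg G v \<noteq> 0"
    and "\<pi> = degree_seq G"
  shows "NG3_graph G \<longleftrightarrow>
    suffix [2, 1] (alpha_part \<pi>) \<and>
    suffix [4, 3] (beta_part \<pi>) \<and>
    length (alpha_part \<pi>) = length (beta_part \<pi>) \<and>
    drop_smallest_two (beta_part \<pi>) majorizes drop_smallest_two (alpha_part \<pi>)"
proof -
  interpret pair_graph G by fact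
  let ?E = "parcs G" and ?V = "pverts G"
  have arcs: "?E \<subseteq> ?V \<times> ?V" using in_arcsD1 in_arcsD2 by auto
  have fin: "finite ?V" by (rule pair_finite_verts)
  have sym: "sym ?E" using pair_sym_arcs by (simp add: symmetric_def)
  have irrefl: "irrefl ?E" using pair_no_loops by (force simp: irrefl_def)
  have deg: "deg G v = deg_in ?E ?V v" for v by (rule deg_eq_deg_in[OF arcs])
  have A: "A_set G = {v \<in> ?V. deg_in ?E ?V v = chi ?E ?V - 1}"
    unfolding A_set_def deg chromatic_number_eq_chi[OF arcs] by (rule refl)
  have "NG3_graph G \<longleftrightarrow> NG_extremal ?E ?V \<and> five_cycle ?E (A_set G)"
    unfolding NG3_graph_def NG_graph_def digraph_iso_cycle_graph_5 five_cycle_iff_bij_betw[OF sym irrefl]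
      NG_extremal_def chromatic_number_eq_chi[OF arcs] chromatic_number_compl_graph
    by (rule refl)
  also have "\<dots> \<longleftrightarrow> (\<exists>A B C. C5_split ?E ?V A B C)"
    unfolding A by (rule NG_extremal_five_cycle_iff[OF fin sym irrefl assms(2)])
  finally have split: "NG3_graph G \<longleftrightarrow> (\<exists>A B C. C5_split ?E ?V A B C)" .
  obtain vs where vs: "distinct vs" "set vs = ?V" "\<pi> = map (deg G) vs"
    and sorted: "sorted_wrt (\<ge>) \<pi>"
    using degree_seq_enumeration[OF fin] assms(4) by metis
  have "\<pi> = map (deg_in ?E ?V) vs" using vs(3) deg by simp
  note columns = C5_split_iff_column_lengths[OF fin sym irrefl vs(1,2) this sorted]
  have "(\<exists>A B C. C5_split ?E ?V A B C) \<longleftrightarrow>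
    (\<exists>p. (column_length \<pi> (p + 1) = p + 5 \<and> column_length \<pi> (p + 2) = p + 5 \<and>
        column_length \<pi> (p + 3) \<le> p) \<and>
      drop_smallest_two (beta_part \<pi>) majorizes drop_smallest_two (alpha_part \<pi>))"
    unfolding columns using majorizes_iff[OF sorted] by (metis (no_types, lifting))
  then show ?thesis unfolding split using smallest_parts_iff[OF sorted] by blast
qed

end
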